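(* Let $\mathbb{K}$ be an algebraically closed field, $V$ a $\mathbb{K}$-vector space of finite positive dimension, and $\Phi=(A;\{E_i\}_{i=0}^d;A^*;\{E_i^*\}_{i=0}^d)$ a TD system on $V$ of diameter $d\geq 1$ that has $q$-Racah type, with fixed associated scalars $q,a,b$. Let the invertible map $\mathcal{M}\in\mathrm{End}(V)$ be as defined in the context. Then for $0\leq i\leq d$, $$\mathcal{M}^{-1}E_iV\subseteq E_{i-1}V+E_iV+E_{i+1}V,$$ where $E_{-1}=0$ and $E_{d+1}=0$.
   Context: TD pair: an ordered pair of linear maps $A,A^*:V\to V$ such that (i) each is diagonalizable; (ii) there is an ordering $\{V_i\}_{i=0}^d$ of the eigenspaces of $A$ with $A^*V_i\subseteq V_{i-1}+V_i+V_{i+1}$ for $0\le i\le d$ ($V_{-1}=V_{d+1}=0$); (iii) there is an ordering $\{V_i^*\}_{i=0}^\delta$ of the eigenspaces of $A^*$ with $AV_i^*\subseteq V_{i-1}^*+V_i^*+V_{i+1}^*$ for $0\le i\le\delta$ ($V^*_{-1}=V^*_{\delta+1}=0$); (iv) no subspace $W$ with $0\ne W\ne V$ satisfies $AW\subseteq W$ and $A^*W\subseteq W$. It is known that $d=\delta$; $d$ is called the diameter. Orderings as in (ii), (iii) are called standard. The primitive idempotent of $A$ for an eigenspace $V_i$ is the projection of $V$ onto $V_i$ that vanishes on the other eigenspaces (similarly for $A^*$). TD system: $(A;\{E_i\}_{i=0}^d;A^*;\{E_i^*\}_{i=0}^d)$ where $A,A^*$ is a TD pair and $\{E_i\}$,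 $\{E_i^*\}$ are the primitive idempotents of $A$, $A^*$, in orders for which the corresponding eigenspace orderings $\{E_iV\}$, $\{E_i^*V\}$ are standard. Let $\theta_i$ (resp. $\theta_i^*$) be the eigenvalue of $A$ on $E_iV$ (resp. of $A^*$ on $E_i^*V$). $\Phi$ has $q$-Racah type if there are nonzero $q,a,b\in\mathbb{K}$ with $q^4\ne1$ and $\theta_i=aq^{d-2i}+a^{-1}q^{2i-d}$, $\theta_i^*=bq^{d-2i}+b^{-1}q^{2i-d}$ for $0\le i\le d$. (Distinctness of eigenvalues forces $q^{2i}\neq1$ for $1\le i\le d$, and $a^2\ne q^{2d-2},q^{2d-4},\dots,q^{2-2d}$; in particular $a^2\neq 1$.) Split decompositions: $U_i=(E_0^*V+\cdots+E_i^*V)\cap(E_iV+\cdots+E_dV)$ and $U_i^\Downarrow=(E_0^*V+\cdots+E_i^*V)\cap(E_0V+\cdots+E_{d-i}V)$ for $0\le i\le d$. It is known that $V=\bigoplus_i U_i=\bigoplus_i U_i^\Downarrow$ with all summands nonzero. $K,B\in\mathrm{End}(V)$ are the linear maps acting on $U_i$, respectively $U_i^\Downarrow$, as the scalar $q^{d-2i}$ ($0\le i\le d$). $\mathcal{M}\in\mathrm{End}(V)$: $\mathcal{M}=\dfrac{aK-a^{-1}B}{a-a^{-1}}$; it is invertible (it is known that $aI-a^{-1}BK^{-1}$ is invertible). *)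

theory Defs
  imports "HOL-Computational_Algebra.Polynomial" "HOL-Library.Set_Algebras"
begin

text \<open>
  The vector space \<open>V\<close> is a type \<open>'b\<close> with a scalar multiplication \<open>(*s)\<close>, and \<open>EV\<close> is rendered as
  \<open>range E\<close>.  Sums of subspaces are the elementwise sums of sets from \<open>Set_Algebras\<close>, so that
  the empty sum is \<open>{0}\<close>.
\<close>

text \<open>
  \<open>padded d W\<close> extends \<open>W 0, \<dots>, W d\<close> by zero subspaces.  It is indexed by integers, because
  \<open>i - 1\<close> would be truncated at \<open>i = 0\<close> on the natural numbers.
\<close>

definition padded :: "nat \<Rightarrow> (nat \<Rightarrow> 'b::zero set) \<Rightarrow> int \<Rightarrow> 'b set" where
  "padded d W j = (if 0 \<le> j \<and> j \<le> int d then W (nat j) else {0})"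

definition neighbour_sum :: "nat \<Rightarrow> (nat \<Rightarrow> 'b::ab_group_add set) \<Rightarrow> nat \<Rightarrow> 'b set" where
  "neighbour_sum d W i =
     padded d W (int i - 1) + padded d W (int i) + padded d W (int i + 1)"

text \<open>
  A locale of its own: definitions made directly in \<open>vector_space\<close> would be instantiated for the
  global interpretation of that locale at \<open>real_vector\<close>.
\<close>

locale td_space = vector_space scale
  for scale :: "'a::field \<Rightarrow> 'b::ab_group_add \<Rightarrow> 'b" (infixr \<open>*s\<close> 75)
begin

definition eigenspace :: "('b \<Rightarrow> 'b) \<Rightarrow> 'a \<Rightarrow> 'b set" where
  "eigenspace A \<theta> = {v. A v = \<theta> *s v}"

definition eigenspaces :: "('b \<Rightarrow> 'b) \<Rightarrow> 'b set set" where
  "eigenspaces A = {eigenspace A \<theta> | \<theta>. eigenspace A \<theta> \<noteq> {0}}"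

definition diagonalizable :: "('b \<Rightarrow> 'b) \<Rightarrow> bool" where
  "diagonalizable A \<longleftrightarrow>
     (\<exists>B. independent B \<and> span B = UNIV \<and> (\<forall>v\<in>B. \<exists>\<theta>. A v = \<theta> *s v))"

definition standard_ordering ::
  "('b \<Rightarrow> 'b) \<Rightarrow> ('b \<Rightarrow> 'b) \<Rightarrow> nat \<Rightarrow> (nat \<Rightarrow> 'b set) \<Rightarrow> bool" where
  "standard_ordering A A' d W \<longleftrightarrow>
     bij_betw W {0..d} (eigenspaces A) \<and>
     (\<forall>i\<le>d. A' ` W i \<subseteq> neighbour_sum d W i)"

definition td_pair :: "('b \<Rightarrow> 'b) \<Rightarrow> ('b \<Rightarrow> 'b) \<Rightarrow> bool" where
  "td_pair A As \<longleftrightarrow>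
     Vector_Spaces.linear scale scale A \<and> Vector_Spaces.linear scale scale As \<and>
     diagonalizable A \<and> diagonalizable As \<and>
     (\<exists>d W. standard_ordering A As d W) \<and>
     (\<exists>\<delta> Ws. standard_ordering As A \<delta> Ws) \<and>
     \<not> (\<exists>W. subspace W \<and> W \<noteq> {0} \<and> W \<noteq> UNIV \<and> A ` W \<subseteq> W \<and> As ` W \<subseteq> W)"

definition primitive_idempotent :: "('b \<Rightarrow> 'b) \<Rightarrow> 'b set \<Rightarrow> ('b \<Rightarrow> 'b) \<Rightarrow> bool" where
  "primitive_idempotent A W P \<longleftrightarrow>
     W \<in> eigenspaces A \<and> Vector_Spaces.linear scale scale P \<and>
     range P = W \<and> (\<forall>v\<in>W. P v = v) \<and>
     (\<forall>W'\<in>eigenspaces A. W' \<noteq> W \<longrightarrow> (\<forall>v\<in>W'. P v = 0))"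

text \<open>Only the values of \<open>E\<close> and \<open>Es\<close> at indices \<open>0, \<dots>, d\<close> matter.\<close>

definition td_system ::
  "nat \<Rightarrow> ('b \<Rightarrow> 'b) \<Rightarrow> (nat \<Rightarrow> 'b \<Rightarrow> 'b) \<Rightarrow> ('b \<Rightarrow> 'b) \<Rightarrow> (nat \<Rightarrow> 'b \<Rightarrow> 'b) \<Rightarrow> bool" where
  "td_system d A E As Es \<longleftrightarrow>
     td_pair A As \<and>
     (\<forall>i\<le>d. primitive_idempotent A (range (E i)) (E i)) \<and>
     (\<forall>i\<le>d. primitive_idempotent As (range (Es i)) (Es i)) \<and>
     standard_ordering A As d (\<lambda>i. range (E i)) \<and>
     standard_ordering As A d (\<lambda>i. range (Es i))"

text \<open>The scalar is unique whenever \<open>W\<close> is an eigenspace of \<open>A\<close>, since then \<open>W \<noteq> {0}\<close>.\<close>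

definition eigenvalue_on :: "('b \<Rightarrow> 'b) \<Rightarrow> 'b set \<Rightarrow> 'a" where
  "eigenvalue_on A W = (THE \<theta>. \<forall>v\<in>W. A v = \<theta> *s v)"

definition q_Racah ::
  "nat \<Rightarrow> ('b \<Rightarrow> 'b) \<Rightarrow> (nat \<Rightarrow> 'b \<Rightarrow> 'b) \<Rightarrow> ('b \<Rightarrow> 'b) \<Rightarrow> (nat \<Rightarrow> 'b \<Rightarrow> 'b) \<Rightarrow>
   'a \<Rightarrow> 'a \<Rightarrow> 'a \<Rightarrow> bool" where
  "q_Racah d A E As Es q a b \<longleftrightarrow>
     q \<noteq> 0 \<and> a \<noteq> 0 \<and> b \<noteq> 0 \<and> q ^ 4 \<noteq> 1 \<and>
     (\<forall>i\<le>d. eigenvalue_on A (range (E i)) =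
        a * q powi (int d - 2 * int i) + inverse a * q powi (2 * int i - int d)) \<and>
     (\<forall>i\<le>d. eigenvalue_on As (range (Es i)) =
        b * q powi (int d - 2 * int i) + inverse b * q powi (2 * int i - int d))"

definition split_U ::
  "nat \<Rightarrow> (nat \<Rightarrow> 'b \<Rightarrow> 'b) \<Rightarrow> (nat \<Rightarrow> 'b \<Rightarrow> 'b) \<Rightarrow> nat \<Rightarrow> 'b set" where
  "split_U d E Es i = (\<Sum>j\<in>{0..i}. range (Es j)) \<inter> (\<Sum>j\<in>{i..d}. range (E j))"

definition split_U_down ::
  "nat \<Rightarrow> (nat \<Rightarrow> 'b \<Rightarrow> 'b) \<Rightarrow> (nat \<Rightarrow> 'b \<Rightarrow> 'b) \<Rightarrow> nat \<Rightarrow> 'b set" where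
  "split_U_down d E Es i = (\<Sum>j\<in>{0..i}. range (Es j)) \<inter> (\<Sum>j\<in>{0..d - i}. range (E j))"

text \<open>
  The linear map acting on \<open>W i\<close> as \<open>q\<^bsup>d - 2i\<^esup>\<close>; it exists and is unique when \<open>V\<close> is the direct
  sum of \<open>W 0, \<dots>, W d\<close>, which is a known property of both split decompositions.
\<close>

definition split_map :: "nat \<Rightarrow> 'a \<Rightarrow> (nat \<Rightarrow> 'b set) \<Rightarrow> 'b \<Rightarrow> 'b" where
  "split_map d q W =
     (THE X. Vector_Spaces.linear scale scale X \<and>
        (\<forall>i\<le>d. \<forall>v\<in>W i. X v = (q powi (int d - 2 * int i)) *s v))"

definition K_map ::
  "nat \<Rightarrow> (nat \<Rightarrow> 'b \<Rightarrow> 'b) \<Rightarrow> (nat \<Rightarrow> 'b \<Rightarrow> 'b) \<Rightarrow> 'a \<Rightarrow> 'b \<Rightarrow> 'b" where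
  "K_map d E Es q = split_map d q (split_U d E Es)"

definition B_map ::
  "nat \<Rightarrow> (nat \<Rightarrow> 'b \<Rightarrow> 'b) \<Rightarrow> (nat \<Rightarrow> 'b \<Rightarrow> 'b) \<Rightarrow> 'a \<Rightarrow> 'b \<Rightarrow> 'b" where
  "B_map d E Es q = split_map d q (split_U_down d E Es)"

definition M_map ::
  "nat \<Rightarrow> (nat \<Rightarrow> 'b \<Rightarrow> 'b) \<Rightarrow> (nat \<Rightarrow> 'b \<Rightarrow> 'b) \<Rightarrow> 'a \<Rightarrow> 'a \<Rightarrow> 'b \<Rightarrow> 'b" where
  "M_map d E Es q a v =
     inverse (a - inverse a) *s (a *s K_map d E Es q v - inverse a *s B_map d E Es q v)"

end

end

theory Submission
  imports Defs
begin

text \<open>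
  Put \<open>F n = E\<^sub>0\<^sup>*V + \<dots> + E\<^bsub>n-1\<^esub>\<^sup>*V\<close> and \<open>G n = E\<^sub>nV + \<dots> + E\<^sub>dV\<close>.  Irreducibility
  yields \<open>F n \<inter> G n = 0\<close> and the decomposition of \<open>V\<close> into the spaces \<open>U\<^sub>i = F (i + 1) \<inter> G i\<close>, hence
  \<open>q\<close>-commutation relations of \<open>K\<close> and \<open>B\<close> with \<open>A\<close> and \<open>A\<^sup>*\<close>.  Write \<open>D = K - M\<close>, so that
  \<open>K = M + D\<close> and \<open>B = M + a\<^sup>2D\<close>.  Commuting \<open>A\<close> or \<open>A\<^sup>*\<close> past \<open>Z = MD - q\<^sup>2DM\<close> produces only terms with a
  factor \<open>Z\<close>, so the smallest subspace that contains \<open>ZV\<close> and is invariant under \<open>M\<close> and \<open>D\<close> is also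
  invariant under \<open>A\<close> and \<open>A\<^sup>*\<close>.  It lies in the proper subspace \<open>F d\<close>, hence vanishes, and
  \<open>MD = q\<^sup>2DM\<close>.  Equivalently \<open>KM\<^sup>-\<^sup>1 - q\<^sup>2M\<^sup>-\<^sup>1K = 1 - q\<^sup>2\<close>, which forces \<open>M\<^sup>-\<^sup>1U\<^sub>i \<subseteq> U\<^bsub>i-1\<^esub> + U\<^sub>i\<close> and
  therefore \<open>M\<^sup>-\<^sup>1 G i \<subseteq> G (i - 1)\<close>.  Reversing the order of the \<open>E\<^sub>i\<close> replaces \<open>a\<close> by \<open>a\<^sup>-\<^sup>1\<close> and exchanges
  \<open>K\<close> and \<open>B\<close> while fixing \<open>M\<close>, which gives the bound from the other side.
\<close>

section \<open>Linear algebra\<close>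

context td_space
begin

abbreviation lin :: "('b \<Rightarrow> 'b) \<Rightarrow> bool" where
  "lin f \<equiv> Vector_Spaces.linear scale scale f"

lemma linI: "(\<And>x y. f (x + y) = f x + f y) \<Longrightarrow> (\<And>c x. f (c *s x) = c *s f x) \<Longrightarrow> lin f"
  by (simp add: Vector_Spaces.linear_iff vector_space_axioms)

lemma lin_add: "lin f \<Longrightarrow> f (x + y) = f x + f y"
  and lin_scale: "lin f \<Longrightarrow> f (c *s x) = c *s f x"
  by (simp_all add: Vector_Spaces.linear_iff)

lemma lin_zero: "lin f \<Longrightarrow> f 0 = 0"
  using lin_add[of f 0 0] by simp

lemma lin_diff: "lin f \<Longrightarrow> f (x - y) = f x - f y"
  using lin_add[of f "x - y" y] by (simp add: algebra_simps)

lemma lin_sum: "lin f \<Longrightarrow> f (\<Sum>i\<in>I. g i) = (\<Sum>i\<in>I. f (g i))"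
  by (induction I rule: infinite_finite_induct) (simp_all add: lin_add lin_zero)

lemma subspace_vimage: "lin f \<Longrightarrow> subspace S \<Longrightarrow> subspace {v. f v \<in> S}"
  by (auto simp: subspace_def lin_add lin_scale lin_zero)

text \<open>Once \<open>A\<close> has been moved to the left, the remaining words in
  \<open>M\<close> and \<open>D\<close> regroup into words containing \<open>Z\<close>. The terms in
  \<open>c\<close>, linear and cubic in \<open>M\<close>, cancel because
  \<open>p * r = 1\<close>.\<close>

lemma cross_relation_lower:
  assumes lin: "lin A" "lin M" "lin D"
    and pr: "p * r = 1"
    and D: "\<And>v. D (A v) = p *s A (D v) + e *s (a *s D (D v) + c *s v - c *s M (M v))"
    and M: "\<And>v. M (A v) = p *s A (M v) + e *s (s *s M (M v) + a *s (M (D v) + D (M v)))"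
    and Z: "\<And>v. Z v = M (D v) - r *s D (M v)"
  shows "Z (A v) = (p * p) *s A (Z v)
    + e *s (s *s (p *s M (Z v) + Z (M v)) + (a * (1 + p)) *s (Z (D v) + D (Z v)))"
proof -
  note [simp] = lin[THEN lin_add] lin[THEN lin_diff] lin[THEN lin_scale]
  have [simp]: "r * p = 1" "p * (r * x) = x" "r * (p * x) = x" for x
    using pr by (auto simp: mult.commute mult.left_commute mult.assoc[symmetric])
  show ?thesis by (simp add: Z D M pr algebra_simps)
qed

text \<open>The terms in \<open>c\<close> and the cubes of \<open>D\<close> cancel between the two
  products; all other words regroup into words containing \<open>Z\<close>.\<close>

lemma cross_relation_raise:
  assumes lin: "lin A" "lin M" "lin D"
    and D: "\<And>v. D (A v) = r *s A (D v) - e *s (M (D v) + D (M v) + (1 + t) *s D (D v))"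
    and M: "\<And>v. M (A v) = r *s A (M v) - e *s (M (M v) - t *s D (D v) + c *s v)"
    and Z: "\<And>v. Z v = M (D v) - r *s D (M v)"
  shows "Z (A v) = (r * r) *s A (Z v)
    - e *s ((1 + r) *s (M (Z v) + Z (M v)) + (1 + t) *s (Z (D v) + r *s D (Z v)))"
proof -
  note [simp] = lin[THEN lin_add] lin[THEN lin_diff] lin[THEN lin_scale]
  show ?thesis by (simp add: Z D M algebra_simps)
qed

end

section \<open>Complete orthogonal families of projections\<close>

locale idempotent_resolution = td_space scale
  for scale :: "'a::field \<Rightarrow> 'b::ab_group_add \<Rightarrow> 'b" (infixr \<open>*s\<close> 75) +
  fixes d :: nat and P :: "nat \<Rightarrow> 'b \<Rightarrow> 'b"
  assumes lin_P: "i \<le> d \<Longrightarrow> lin (P i)"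
    and complete: "(\<Sum>i\<le>d. P i v) = v"
    and orth: "i \<le> d \<Longrightarrow> j \<le> d \<Longrightarrow> i \<noteq> j \<Longrightarrow> P i (P j v) = 0"
begin

text \<open>Both are sums of ranges (\<open>sum_range_eq\<close> below), described as common kernels.\<close>

definition below :: "nat \<Rightarrow> 'b set" where
  "below n = {v. \<forall>j\<le>d. n \<le> j \<longrightarrow> P j v = 0}"

definition above :: "nat \<Rightarrow> 'b set" where
  "above n = {v. \<forall>j\<le>d. j < n \<longrightarrow> P j v = 0}"

lemma idem: "i \<le> d \<Longrightarrow> P i (P i v) = P i v"
proof -
  assume i: "i \<le> d"
  have "P i v = P i (\<Sum>j\<le>d. P j v)" by (simp add: complete)
  also have "\<dots> = (\<Sum>j\<le>d. P i (P j v))" by (simp add: lin_sum lin_P i)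
  also have "\<dots> = (\<Sum>j\<le>d. if j = i then P i (P i v) else 0)"
    by (rule sum.cong) (use i orth in auto)
  finally show ?thesis using i by simp
qed

lemma eq_0I: "(\<And>j. j \<le> d \<Longrightarrow> P j v = 0) \<Longrightarrow> v = 0"
  using complete[of v] by simp

text \<open>By completeness a vector is the sum of its components, so those outside \<open>I\<close>
  may be dropped when they vanish; orthogonality gives the converse.\<close>

lemma sum_range_eq:
  assumes "I \<subseteq> {..d}"
  shows "(\<Sum>j\<in>I. range (P j)) = {v. \<forall>j\<le>d. j \<notin> I \<longrightarrow> P j v = 0}"
proof -
  have fin: "finite I" using assms finite_subset by blast
  have "\<exists>s. v = sum s I \<and> (\<forall>j\<in>I. s j \<in> range (P j))" if "\<forall>j\<le>d. j \<notin> I \<longrightarrow> P j v = 0" for v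
  proof (intro exI conjI ballI)
    have "(\<Sum>j\<le>d. P j v) = (\<Sum>j\<in>I. P j v)"
      by (rule sum.mono_neutral_right) (use assms that in auto)
    then show "v = (\<Sum>j\<in>I. P j v)" by (simp add: complete)
  qed auto
  moreover have "P k (sum s I) = 0" if "\<forall>j\<in>I. s j \<in> range (P j)" "k \<le> d" "k \<notin> I" for s k
    unfolding lin_sum[OF lin_P[OF that(2)]]
    by (rule sum.neutral) (use that assms orth in fastforce)
  ultimately show ?thesis unfolding set_sum_alt[OF fin] by blast
qed

lemma subspace_below: "subspace (below n)" and subspace_above: "subspace (above n)"
  by (auto simp: subspace_def below_def above_def lin_P lin_add lin_scale lin_zero)

lemma below_0: "below 0 = {0}"
  by (auto simp: below_def lin_zero lin_P intro: eq_0I)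

lemma below_top: "d < n \<Longrightarrow> below n = UNIV"
  by (auto simp: below_def)

lemma above_0: "above 0 = UNIV"
  by (auto simp: above_def)

lemma above_top: "d < n \<Longrightarrow> above n = {0}"
  by (auto simp: above_def lin_zero lin_P intro: eq_0I)

lemma below_mono: "m \<le> n \<Longrightarrow> below m \<subseteq> below n"
  and above_antimono: "m \<le> n \<Longrightarrow> above n \<subseteq> above m"
  by (auto simp: below_def above_def)

lemma P_eigen:
  assumes "lin X" "\<And>i v. i \<le> d \<Longrightarrow> X (P i v) = c i *s P i v" "i \<le> d"
  shows "P i (X v) = c i *s P i v"
proof -
  have "P i (X v) = P i (X (\<Sum>j\<le>d. P j v))" by (simp add: complete)
  also have "\<dots> = (\<Sum>j\<le>d. P i (c j *s P j v))"
    using assms by (simp add: lin_sum lin_P)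
  also have "\<dots> = (\<Sum>j\<le>d. if j = i then c i *s P i v else 0)"
    by (rule sum.cong) (use assms orth in \<open>auto simp: lin_scale lin_P idem\<close>)
  finally show ?thesis using assms by simp
qed

lemma P_tridiagonal:
  assumes "lin X" "\<And>i j v. i \<le> d \<Longrightarrow> j \<le> d \<Longrightarrow> i + 1 < j \<or> j + 1 < i \<Longrightarrow> P j (X (P i v)) = 0"
    and "j \<le> d" "\<And>i. i \<le> d \<Longrightarrow> i \<le> j + 1 \<Longrightarrow> j \<le> i + 1 \<Longrightarrow> P i v = 0"
  shows "P j (X v) = 0"
proof -
  have "P j (X v) = P j (X (\<Sum>i\<le>d. P i v))" by (simp add: complete)
  also have "\<dots> = (\<Sum>i\<le>d. P j (X (P i v)))"
    using assms by (simp add: lin_sum lin_P)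
  also have "\<dots> = 0"
  proof (intro sum.neutral ballI)
    fix i assume "i \<in> {..d}"
    then show "P j (X (P i v)) = 0"
      using assms by (cases "i \<le> j + 1 \<and> j \<le> i + 1") (auto simp: lin_zero lin_P)
  qed
  finally show ?thesis .
qed

text \<open>Under reversal \<open>above\<close> describes sums of initial ranges, which is how the
  second split decomposition becomes an instance of the first.\<close>

lemma reversed: "idempotent_resolution scale d (\<lambda>j. P (d - j))"
proof (intro idempotent_resolution.intro[OF td_space_axioms] idempotent_resolution_axioms.intro)
  show "(\<Sum>j\<le>d. P (d - j) v) = v" for v
    using sum.nat_diff_reindex[of "\<lambda>j. P j v" "Suc d"] complete[of v]
    by (simp add: lessThan_Suc_atMost)
qed (auto simp: lin_P orth)

end

section \<open>The split decomposition\<close>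

text \<open>The tridiagonal conditions are encoded as vanishing products of projections, a form that
  acts on single components and is stable under reversal of \<open>E\<close>.\<close>

locale split_system =
  E: idempotent_resolution scale d E + Es: idempotent_resolution scale d Es
  for scale :: "'a::field \<Rightarrow> 'b::ab_group_add \<Rightarrow> 'b" (infixr \<open>*s\<close> 75)
    and d :: nat and E Es :: "nat \<Rightarrow> 'b \<Rightarrow> 'b" +
  fixes A As :: "'b \<Rightarrow> 'b" and \<theta> \<theta>s :: "nat \<Rightarrow> 'a"
  assumes lin_A: "E.lin A" and lin_As: "E.lin As"
    and A_E: "i \<le> d \<Longrightarrow> A (E i v) = \<theta> i *s E i v"
    and As_Es: "i \<le> d \<Longrightarrow> As (Es i v) = \<theta>s i *s Es i v"
    and As_E: "i \<le> d \<Longrightarrow> j \<le> d \<Longrightarrow> i + 1 < j \<or> j + 1 < i \<Longrightarrow> E j (As (E i v)) = 0"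
    and A_Es: "i \<le> d \<Longrightarrow> j \<le> d \<Longrightarrow> i + 1 < j \<or> j + 1 < i \<Longrightarrow> Es j (A (Es i v)) = 0"
    and E_nonzero: "i \<le> d \<Longrightarrow> \<exists>v. E i v \<noteq> 0"
    and Es_nonzero: "i \<le> d \<Longrightarrow> \<exists>v. Es i v \<noteq> 0"
    and irreducible: "E.subspace W \<Longrightarrow> (\<And>w. w \<in> W \<Longrightarrow> A w \<in> W) \<Longrightarrow> (\<And>w. w \<in> W \<Longrightarrow> As w \<in> W)
      \<Longrightarrow> W = {0} \<or> W = UNIV"
begin

abbreviation "F \<equiv> Es.below"
abbreviation "G \<equiv> E.above"
abbreviation "U i \<equiv> F (Suc i) \<inter> G i"

text \<open>\<open>A - \<theta> n\<close> kills the component in the range of \<open>E n\<close> and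
  rescales the later ones. Beyond \<open>d\<close> the space \<open>G n\<close> is zero, so no value
  of \<open>\<theta> n\<close> can do harm.\<close>

lemma A_G: "v \<in> G n \<Longrightarrow> A v - \<theta> n *s v \<in> G (Suc n)"
  by (auto simp: E.above_def less_Suc_eq E.lin_P E.lin_diff E.lin_scale E.P_eigen[where X = A and c = \<theta>, OF lin_A A_E])

lemma As_G: "v \<in> G n \<Longrightarrow> As v \<in> G (n - 1)"
  unfolding E.above_def by (auto intro!: E.P_tridiagonal[where X = As, OF lin_As As_E])

lemma A_F: "v \<in> F n \<Longrightarrow> A v \<in> F (Suc n)"
  unfolding Es.below_def by (auto intro!: Es.P_tridiagonal[where X = A, OF lin_A A_Es])

lemma As_F: "v \<in> F (Suc n) \<Longrightarrow> As v - \<theta>s n *s v \<in> F n"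
proof -
  assume v: "v \<in> F (Suc n)"
  have "Es j (As v - \<theta>s n *s v) = 0" if j: "j \<le> d" "n \<le> j" for j
  proof -
    have "Es j (As v - \<theta>s n *s v) = (\<theta>s j - \<theta>s n) *s Es j v"
      using Es.P_eigen[where X = As and c = \<theta>s, OF lin_As As_Es j(1)]
      by (simp add: E.lin_diff[OF Es.lin_P[OF j(1)]] E.lin_scale[OF Es.lin_P[OF j(1)]]
          E.scale_left_diff_distrib)
    moreover have "j = n \<or> Es j v = 0" using v j by (auto simp: Es.below_def)
    ultimately show ?thesis by auto
  qed
  then show ?thesis by (simp add: Es.below_def)
qed

lemma A_FG: "v \<in> F m \<inter> G n \<Longrightarrow> A v - \<theta> n *s v \<in> F (Suc m) \<inter> G (Suc n)"
  using A_G[of v n] A_F[of v m] Es.below_mono[of m "Suc m"]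
  by (auto intro!: E.subspace_diff[OF Es.subspace_below] E.subspace_scale[OF Es.subspace_below])

lemma As_FG: "v \<in> F (Suc m) \<inter> G n \<Longrightarrow> As v - \<theta>s m *s v \<in> F m \<inter> G (n - 1)"
  using As_F[of v m] As_G[of v n] E.above_antimono[of "n - 1" n]
  by (auto intro!: E.subspace_diff[OF E.subspace_above] E.subspace_scale[OF E.subspace_above])

text \<open>For \<open>r > 0\<close> this span lies in \<open>G 1\<close> and so vanishes; for \<open>r = 0\<close> it is all of \<open>V\<close>.\<close>

lemma span_diagonal:
  fixes r
  defines "W \<equiv> E.span (\<Union>i. F (Suc i) \<inter> G (i + r))"
  shows "W = {0} \<or> W = UNIV"
proof (rule irreducible)
  show sub: "E.subspace W" unfolding W_def by (rule E.subspace_span)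
  have mem: "v \<in> W" if "v \<in> F (Suc i) \<inter> G (i + r)" for v i
    unfolding W_def using that by (intro E.span_base) blast
  show "A w \<in> W" if "w \<in> W" for w
    using that unfolding W_def
  proof (induction rule: E.span_induct)
    show "E.subspace {x. A x \<in> E.span (\<Union>i. F (Suc i) \<inter> G (i + r))}"
      by (rule E.subspace_vimage[OF lin_A E.subspace_span])
  next
    fix x assume "x \<in> (\<Union>i. F (Suc i) \<inter> G (i + r))"
    then obtain i where x: "x \<in> F (Suc i) \<inter> G (i + r)" by blast
    have "A x - \<theta> (i + r) *s x \<in> W" using A_FG[OF x] by (intro mem[of _ "Suc i"]) simp
    from E.subspace_add[OF sub this E.subspace_scale[OF sub mem[OF x]]]
    show "A x \<in> E.span (\<Union>i. F (Suc i) \<inter> G (i + r))" by (metis W_def diff_add_cancel)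
  qed
  show "As w \<in> W" if "w \<in> W" for w
    using that unfolding W_def
  proof (induction rule: E.span_induct)
    show "E.subspace {x. As x \<in> E.span (\<Union>i. F (Suc i) \<inter> G (i + r))}"
      by (rule E.subspace_vimage[OF lin_As E.subspace_span])
  next
    fix x assume "x \<in> (\<Union>i. F (Suc i) \<inter> G (i + r))"
    then obtain i where x: "x \<in> F (Suc i) \<inter> G (i + r)" by blast
    have "As x - \<theta>s i *s x \<in> W"
    \<comment> \<open>\<open>As\<close> lowers the index of the diagonal by one. At
      \<open>i = 0\<close> the difference lies in \<open>F 0\<close>, which is zero.\<close>
    proof (cases i)
      case 0
      then show ?thesis using As_FG[OF x] by (simp add: Es.below_0 E.subspace_0[OF sub])
    next
      case (Suc k)
      then show ?thesis using As_FG[OF x] by (intro mem[of _ k]) simp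
    qed
    from E.subspace_add[OF sub this E.subspace_scale[OF sub mem[OF x]]]
    show "As x \<in> E.span (\<Union>i. F (Suc i) \<inter> G (i + r))" by (metis W_def diff_add_cancel)
  qed
qed

text \<open>For \<open>n = m + 1\<close> the intersection is a member of the diagonal family with
  \<open>r = 1\<close>. Its span lies in \<open>G 1\<close>, which is proper because
  \<open>E 0\<close> is nonzero, so irreducibility makes it zero.\<close>

lemma F_inter_G: "F n \<inter> G n = {0}"
proof (cases n)
  case 0
  then show ?thesis by (auto simp: Es.below_0 E.subspace_0 E.subspace_above)
next
  case (Suc m)
  let ?W = "E.span (\<Union>i. F (Suc i) \<inter> G (i + 1))"
  have "?W \<subseteq> G 1"
    by (rule E.span_minimal) (use E.above_antimono[of 1 "_ + 1"] E.subspace_above in auto)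
  moreover obtain v where "E 0 v \<noteq> 0" using E_nonzero by blast
  then have "v \<notin> G 1" by (auto simp: E.above_def)
  ultimately have "?W = {0}" using span_diagonal[of 1] by blast
  moreover have "F n \<inter> G n \<subseteq> ?W"
  proof
    fix x assume "x \<in> F n \<inter> G n"
    then have "x \<in> (\<Union>i. F (Suc i) \<inter> G (i + 1))" using Suc by auto
    then show "x \<in> ?W" by (rule E.span_base)
  qed
  moreover have "0 \<in> F n \<inter> G n"
    by (simp add: E.subspace_0[OF Es.subspace_below] E.subspace_0[OF E.subspace_above])
  ultimately show ?thesis by blast
qed

lemma F_neq_UNIV: "F d \<noteq> UNIV"
proof -
  obtain v where "Es d v \<noteq> 0" using Es_nonzero by blast
  then have "v \<notin> F d" by (auto simp: Es.below_def)
  then show ?thesis by auto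
qed

text \<open>The sums of vectors from the \<open>U j\<close> form a subspace that contains the span
  of the diagonal family with \<open>r = 0\<close>; this span is all of V as soon as it is
  nonzero.\<close>

lemma split_decomposition: "\<exists>u. (\<forall>j\<le>d. u j \<in> U j) \<and> (\<Sum>j\<le>d. u j) = v"
proof -
  let ?S = "{v. \<exists>u. (\<forall>j\<le>d. u j \<in> U j) \<and> (\<Sum>j\<le>d. u j) = v}"
  have subU: "E.subspace (U j)" for j
    by (rule E.subspace_inter[OF Es.subspace_below E.subspace_above])
  have sub: "E.subspace ?S"
  proof (unfold E.subspace_def, safe)
    show "\<exists>u. (\<forall>j\<le>d. u j \<in> U j) \<and> (\<Sum>j\<le>d. u j) = 0"
      by (rule exI[of _ "\<lambda>_. 0"]) (use E.subspace_0[OF subU] in auto)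
  next
    fix u u' assume "\<forall>j\<le>d. u j \<in> U j" "\<forall>j\<le>d. u' j \<in> U j"
    then show "\<exists>w. (\<forall>j\<le>d. w j \<in> U j) \<and> (\<Sum>j\<le>d. w j) = sum u {..d} + sum u' {..d}"
      by (intro exI[of _ "\<lambda>j. u j + u' j"]) (use E.subspace_add[OF subU] in \<open>auto simp: sum.distrib\<close>)
  next
    fix c u assume "\<forall>j\<le>d. u j \<in> U j"
    then show "\<exists>w. (\<forall>j\<le>d. w j \<in> U j) \<and> (\<Sum>j\<le>d. w j) = c *s sum u {..d}"
      by (intro exI[of _ "\<lambda>j. c *s u j"])
        (use E.subspace_scale[OF subU] in \<open>auto simp: E.scale_sum_right\<close>)
  qed
  have "(\<Union>i. F (Suc i) \<inter> G (i + 0)) \<subseteq> ?S"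
  proof safe
    fix x i assume x: "x \<in> F (Suc i)" "x \<in> G (i + 0)"
    show "\<exists>u. (\<forall>j\<le>d. u j \<in> U j) \<and> (\<Sum>j\<le>d. u j) = x"
    proof (cases "i \<le> d")
      case True
      then show ?thesis
        by (intro exI[of _ "\<lambda>j. if j = i then x else 0"]) (use x E.subspace_0[OF subU] in auto)
    next
      case False
      then have "x = 0" using x E.above_top by auto
      then show ?thesis using sub E.subspace_0 by auto
    qed
  qed
  then have le: "E.span (\<Union>i. F (Suc i) \<inter> G (i + 0)) \<subseteq> ?S" by (rule E.span_minimal[OF _ sub])
  \<comment> \<open>A nonzero vector of the span: the range of \<open>Es 0\<close> lies in
    \<open>F 1\<close>, and \<open>G 0\<close> is everything.\<close>
  obtain v where "Es 0 v \<noteq> 0" using Es_nonzero by blast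
  then have "Es 0 v \<in> F (Suc 0) \<inter> G (0 + 0)" "Es 0 v \<noteq> 0"
    by (auto simp: E.above_0 Es.below_def Es.orth)
  then have "E.span (\<Union>i. F (Suc i) \<inter> G (i + 0)) \<noteq> {0}" by (metis (no_types, lifting) E.span_base UN_I UNIV_I singletonD)
  then show ?thesis using span_diagonal[of 0] le by blast
qed

text \<open>Once the earlier terms vanish, \<open>x i\<close> is minus a sum of later terms, so it
  lies in \<open>F (Suc i) \<inter> G (Suc i)\<close>, which is zero.\<close>

lemma split_independent:
  assumes "\<And>j. j \<le> d \<Longrightarrow> x j \<in> U j" "(\<Sum>j\<le>d. x j) = 0" "i \<le> d"
  shows "x i = 0"
  using assms(3)
proof (induction i rule: less_induct)
  case (less i)
  have "{..d} = insert i ({..<i} \<union> {i<..d})" using less.prems by auto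
  then have "(\<Sum>j\<le>d. x j) = x i + (sum x {..<i} + sum x {i<..d})"
    by (simp add: sum.union_disjoint Int_commute disjoint_iff)
  moreover have "sum x {..<i} = 0" using less by (intro sum.neutral) auto
  ultimately have eq: "x i = - sum x {i<..d}" using assms(2) by (simp add: add_eq_0_iff)
  have "x j \<in> G (Suc i)" if "j \<in> {i<..d}" for j
    using assms(1)[of j] that E.above_antimono[of "Suc i" j] by auto
  then have "x i \<in> G (Suc i)"
    unfolding eq by (intro E.subspace_neg E.subspace_sum E.subspace_above)
  then show ?case using F_inter_G[of "Suc i"] assms(1)[OF less.prems] by blast
qed

text \<open>In the split decomposition of \<open>v\<close> the components beyond \<open>i\<close>
  add up to an element of both \<open>F (Suc i)\<close> and \<open>G (Suc i)\<close>, hence to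
  zero.\<close>

lemma F_split: "\<exists>u \<in> U i. v - u \<in> F i" if "i \<le> d" "v \<in> F (Suc i)"
proof -
  obtain u where u: "\<And>j. j \<le> d \<Longrightarrow> u j \<in> U j" "(\<Sum>j\<le>d. u j) = v" using split_decomposition by blast
  have "{..d} = insert i ({..<i} \<union> {i<..d})" using that by auto
  then have v: "v = u i + (sum u {..<i} + sum u {i<..d})"
    unfolding u(2)[symmetric] by (simp add: sum.union_disjoint Int_commute disjoint_iff)
  have "u j \<in> F i" if "j \<in> {..<i}" for j
    using u(1)[of j] that \<open>i \<le> d\<close> Es.below_mono[of "Suc j" i] by auto
  then have lo: "sum u {..<i} \<in> F i" by (rule E.subspace_sum[OF Es.subspace_below])
  have "u j \<in> G (Suc i)" if "j \<in> {i<..d}" for j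
    using u(1)[of j] that E.above_antimono[of "Suc i" j] by auto
  then have "sum u {i<..d} \<in> G (Suc i)" by (rule E.subspace_sum[OF E.subspace_above])
  moreover have "sum u {i<..d} = v - u i - sum u {..<i}" using v by simp
  then have "sum u {i<..d} \<in> F (Suc i)"
    using that u(1)[of i] lo Es.below_mono[of i "Suc i"]
    by (auto intro!: E.subspace_diff[OF Es.subspace_below])
  ultimately have "sum u {i<..d} = 0" using F_inter_G by blast
  then show ?thesis using u(1)[OF that(1)] lo v by (intro bexI[of _ "u i"]) auto
qed

text \<open>Dually, the components before \<open>i\<close> add up to an element of
  \<open>F i \<inter> G i\<close>.\<close>

lemma G_split: "\<exists>u \<in> U i. v - u \<in> G (Suc i)" if "i \<le> d" "v \<in> G i"
proof -
  obtain u where u: "\<And>j. j \<le> d \<Longrightarrow> u j \<in> U j" "(\<Sum>j\<le>d. u j) = v" using split_decomposition by blast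
  have "{..d} = insert i ({..<i} \<union> {i<..d})" using that by auto
  then have v: "v = u i + (sum u {..<i} + sum u {i<..d})"
    unfolding u(2)[symmetric] by (simp add: sum.union_disjoint Int_commute disjoint_iff)
  have "u j \<in> F i" if "j \<in> {..<i}" for j
    using u(1)[of j] that \<open>i \<le> d\<close> Es.below_mono[of "Suc j" i] by auto
  then have "sum u {..<i} \<in> F i" by (rule E.subspace_sum[OF Es.subspace_below])
  moreover have "u j \<in> G (Suc i)" if "j \<in> {i<..d}" for j
    using u(1)[of j] that E.above_antimono[of "Suc i" j] by auto
  then have hi: "sum u {i<..d} \<in> G (Suc i)" by (rule E.subspace_sum[OF E.subspace_above])
  have "sum u {..<i} = v - u i - sum u {i<..d}" using v by simp
  then have "sum u {..<i} \<in> G i"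
    using that u(1)[of i] hi E.above_antimono[of i "Suc i"]
    by (auto intro!: E.subspace_diff[OF E.subspace_above])
  ultimately have "sum u {..<i} = 0" using F_inter_G by blast
  then show ?thesis using u(1)[OF that(1)] hi v by (intro bexI[of _ "u i"]) auto
qed

lemma split_linear_eq:
  assumes "E.lin X" "E.lin Y" "\<And>i v. i \<le> d \<Longrightarrow> v \<in> U i \<Longrightarrow> X v = Y v"
  shows "X v = Y v"
proof -
  obtain u where u: "\<And>j. j \<le> d \<Longrightarrow> u j \<in> U j" "(\<Sum>j\<le>d. u j) = v" using split_decomposition by blast
  show ?thesis unfolding u(2)[symmetric] using assms u(1) by (simp add: E.lin_sum)
qed

text \<open>Components \<open>p v j\<close> are chosen for every vector; their uniqueness makes the
  choice linear, so rescaling the components is a linear map.\<close>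

lemma split_linear_exists:
  "\<exists>X. E.lin X \<and> (\<forall>i\<le>d. \<forall>v\<in>U i. X v = c i *s v)"
proof -
  have subU: "E.subspace (U j)" for j
    by (rule E.subspace_inter[OF Es.subspace_below E.subspace_above])
  obtain p where p: "\<And>v j. j \<le> d \<Longrightarrow> p v j \<in> U j" "\<And>v. (\<Sum>j\<le>d. p v j) = v"
    using split_decomposition by metis
  have uniq: "p v i = u i" if "\<And>j. j \<le> d \<Longrightarrow> u j \<in> U j" "(\<Sum>j\<le>d. u j) = v" "i \<le> d" for u v i
    using split_independent[of "\<lambda>j. p v j - u j" i] that p(1)[of _ v] p(2)[of v]
    by (simp add: sum_subtractf E.subspace_diff[OF Es.subspace_below] E.subspace_diff[OF E.subspace_above])
  have add: "p (x + y) i = p x i + p y i" if "i \<le> d" for x y i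
    using uniq[of "\<lambda>j. p x j + p y j" "x + y" i] that p E.subspace_add[OF subU]
    by (simp add: sum.distrib)
  have sc: "p (k *s x) i = k *s p x i" if "i \<le> d" for k x i
    using uniq[of "\<lambda>j. k *s p x j" "k *s x" i] that p E.subspace_scale[OF subU]
    by (simp add: E.scale_sum_right[symmetric])
  have U: "p u j = (if j = i then u else 0)" if "i \<le> d" "u \<in> U i" "j \<le> d" for u i j
    using that E.subspace_0[OF subU] by (intro uniq) auto
  show ?thesis
  proof (intro exI conjI allI impI ballI)
    show "E.lin (\<lambda>v. \<Sum>j\<le>d. c j *s p v j)"
      by (rule E.linI)
        (simp_all add: add sc E.scale_right_distrib sum.distrib E.scale_sum_right mult.commute)
    show "(\<Sum>j\<le>d. c j *s p v j) = c i *s v" if "i \<le> d" "v \<in> U i" for i v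
    proof -
      have "(\<Sum>j\<le>d. c j *s p v j) = (\<Sum>j\<le>d. if j = i then c i *s v else 0)"
        by (rule sum.cong) (use U that in auto)
      then show ?thesis using that by simp
    qed
  qed
qed

end

section \<open>The q-Racah relations\<close>

definition (in td_space) jointly_invariant :: "('b \<Rightarrow> 'b) \<Rightarrow> ('b \<Rightarrow> 'b) \<Rightarrow> 'b set \<Rightarrow> bool" where
  "jointly_invariant M D S \<longleftrightarrow> subspace S \<and> (\<forall>x\<in>S. M x \<in> S \<and> D x \<in> S)"

lemma (in td_space) jointly_invariant_hull: "jointly_invariant M D (jointly_invariant M D hull X)"
  by (rule hull_in) (auto simp: jointly_invariant_def intro: subspace_Inter)

text \<open>The vectors of the hull that \<open>X\<close> sends back into the hull form a jointly
  invariant subspace containing the range of \<open>Z\<close>. By minimality they are the whole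
  hull.\<close>

lemma (in td_space) jointly_invariant_hull_invariant:
  fixes M D Z X :: "'b \<Rightarrow> 'b"
  assumes lin: "lin X" "lin M" "lin D" and c: "c \<noteq> 0" "c' \<noteq> 0"
    and M: "\<And>S v. jointly_invariant M D S \<Longrightarrow> v \<in> S \<Longrightarrow> M (X v) - c *s X (M v) \<in> S"
    and D: "\<And>S v. jointly_invariant M D S \<Longrightarrow> v \<in> S \<Longrightarrow> D (X v) - c *s X (D v) \<in> S"
    and Z: "\<And>S v. jointly_invariant M D S \<Longrightarrow> range Z \<subseteq> S \<Longrightarrow> Z (X v) - c' *s X (Z v) \<in> S"
    and w: "w \<in> jointly_invariant M D hull range Z"
  shows "X w \<in> jointly_invariant M D hull range Z"
proof -
  let ?W = "jointly_invariant M D hull range Z"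
  have W: "jointly_invariant M D ?W"
    by (rule jointly_invariant_hull)
  then have sub: "subspace ?W" and MW: "x \<in> ?W \<Longrightarrow> M x \<in> ?W" and DW: "x \<in> ?W \<Longrightarrow> D x \<in> ?W" for x
    by (auto simp: jointly_invariant_def)
  \<comment> \<open>This solves a commutation relation for the term in which \<open>X\<close> comes
    last, which is possible since its coefficient is nonzero.\<close>
  have cancel: "y \<in> ?W" if "x - k *s y \<in> ?W" "x \<in> ?W" "k \<noteq> 0" for x y k
  proof -
    have "inverse k *s (x - (x - k *s y)) \<in> ?W"
      by (intro subspace_scale[OF sub] subspace_diff[OF sub] that)
    then show ?thesis using that by simp
  qed
  have ZW: "Z x \<in> ?W" for x by (rule hull_inc) simp
  have "?W \<subseteq> ?W \<inter> {w. X w \<in> ?W}"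
  proof (rule hull_minimal)
    show "range Z \<subseteq> ?W \<inter> {w. X w \<in> ?W}"
      using ZW cancel[OF Z[OF W] ZW c(2)] by blast
    show "jointly_invariant M D (?W \<inter> {w. X w \<in> ?W})"
    proof (rule jointly_invariant_def[THEN iffD2], intro conjI ballI)
      show "subspace (?W \<inter> {w. X w \<in> ?W})"
        by (intro subspace_inter sub subspace_vimage lin)
      fix x assume x: "x \<in> ?W \<inter> {w. X w \<in> ?W}"
      then show "M x \<in> ?W \<inter> {w. X w \<in> ?W}" "D x \<in> ?W \<inter> {w. X w \<in> ?W}"
        using MW DW cancel[OF M[OF W, of x] MW c(1)] cancel[OF D[OF W, of x] DW c(1)] by auto
    qed
  qed
  then show ?thesis using w by blast
qed

text \<open>Reversing \<open>E\<close> changes \<open>a\<close> but not the scalars by which the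
  split maps act; with \<open>\<kappa>\<close> as a parameter both orders share it.\<close>

locale q_racah_split = split_system scale d E Es A As \<theta> \<theta>s
  for scale :: "'a::field \<Rightarrow> 'b::ab_group_add \<Rightarrow> 'b" (infixr \<open>*s\<close> 75)
    and d E Es A As \<theta> \<theta>s +
  fixes q a b :: 'a and \<kappa> :: "nat \<Rightarrow> 'a"
  assumes \<kappa>_def: "\<And>i. \<kappa> i = q powi (int d - 2 * int i)"
    and q_nonzero: "q \<noteq> 0" and a_nonzero: "a \<noteq> 0" and b_nonzero: "b \<noteq> 0" and a_square: "a * a \<noteq> 1"
    and \<kappa>_inj: "i \<le> d \<Longrightarrow> j \<le> d \<Longrightarrow> i \<noteq> j \<Longrightarrow> \<kappa> i \<noteq> \<kappa> j"
    and \<theta>_eq: "i \<le> d \<Longrightarrow> \<theta> i = a * \<kappa> i + inverse a * inverse (\<kappa> i)"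
    and \<theta>s_eq: "i \<le> d \<Longrightarrow> \<theta>s i = b * \<kappa> i + inverse b * inverse (\<kappa> i)"
begin

abbreviation "r \<equiv> q * q"
abbreviation "p \<equiv> inverse q * inverse q"

lemma \<kappa>_nonzero: "\<kappa> i \<noteq> 0"
  by (simp add: \<kappa>_def q_nonzero)

lemma \<kappa>_pred: "\<kappa> i = r * \<kappa> (Suc i)"
proof -
  have "q powi (m + 2) = q * q * q powi m" for m
    using q_nonzero by (simp add: power_int_add power2_eq_square mult.commute)
  moreover have "int d - 2 * int i = (int d - 2 * int (Suc i)) + 2" by simp
  ultimately show ?thesis unfolding \<kappa>_def by metis
qed

lemma \<kappa>_Suc: "\<kappa> (Suc i) = p * \<kappa> i"
  using q_nonzero by (simp add: \<kappa>_pred[of i] field_simps)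

text \<open>Follows the description in \<open>split_map\<close>, with the summands written as
  kernels, so that the two maps can be identified once the summands agree.\<close>

definition K :: "'b \<Rightarrow> 'b" where
  "K = (THE X. E.lin X \<and> (\<forall>i\<le>d. \<forall>v\<in>U i. X v = \<kappa> i *s v))"

lemma lin_K: "E.lin K" and K_U: "i \<le> d \<Longrightarrow> v \<in> U i \<Longrightarrow> K v = \<kappa> i *s v"
proof -
  have "\<exists>!X. E.lin X \<and> (\<forall>i\<le>d. \<forall>v\<in>U i. X v = \<kappa> i *s v)"
  proof (rule ex_ex1I)
    show "\<exists>X. E.lin X \<and> (\<forall>i\<le>d. \<forall>v\<in>U i. X v = \<kappa> i *s v)" by (rule split_linear_exists)
    show "X = Y" if "E.lin X \<and> (\<forall>i\<le>d. \<forall>v\<in>U i. X v = \<kappa> i *s v)"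
      "E.lin Y \<and> (\<forall>i\<le>d. \<forall>v\<in>U i. Y v = \<kappa> i *s v)" for X Y
    proof
      fix v show "X v = Y v" by (rule split_linear_eq) (use that in auto)
    qed
  qed
  from theI'[OF this, folded K_def] show "E.lin K" and "i \<le> d \<Longrightarrow> v \<in> U i \<Longrightarrow> K v = \<kappa> i *s v"
    by blast+
qed

text \<open>This is the relation \<open>(q K A - q^-1 A K) / (q - q^-1) = a K^2 + a^-1\<close>. It
  holds on each \<open>U i\<close> because \<open>A - \<theta> i\<close> maps \<open>U i\<close>
  into the next summand, where \<open>K\<close> has the scalar
  \<open>p * \<kappa> i\<close>.\<close>

lemma K_A: "K (A v) = p *s A (K v) + (1 - p) *s (a *s K (K v) + inverse a *s v)"
proof (rule split_linear_eq[where X = "\<lambda>v. K (A v)"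
      and Y = "\<lambda>v. p *s A (K v) + (1 - p) *s (a *s K (K v) + inverse a *s v)"])
  note [simp] = lin_A[THEN E.lin_add] lin_A[THEN E.lin_scale] lin_K[THEN E.lin_add] lin_K[THEN E.lin_scale]
  show "E.lin (\<lambda>v. K (A v))"
    by (rule E.linI) simp_all
  show "E.lin (\<lambda>v. p *s A (K v) + (1 - p) *s (a *s K (K v) + inverse a *s v))"
    by (rule E.linI) (simp_all add: algebra_simps)
  fix i u assume i: "i \<le> d" and u: "u \<in> U i"
  define w where "w = A u - \<theta> i *s u"
  have Au: "A u = \<theta> i *s u + w" by (simp add: w_def)
  have w: "w \<in> F (Suc (Suc i)) \<inter> G (Suc i)" using A_FG[OF u] by (simp add: w_def)
  have Kw: "K w = (p * \<kappa> i) *s w"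
  proof (cases "Suc i \<le> d")
    case True
    then show ?thesis using K_U[OF True w] by (simp add: \<kappa>_Suc)
  next
    case False
    then have "w = 0" using w by (simp add: E.above_top)
    then show ?thesis by (simp add: E.lin_zero lin_K)
  qed
  \<comment> \<open>The coefficient of \<open>u\<close> matches because
    \<open>\<theta> i * \<kappa> i\<close> equals
    \<open>a * \<kappa> i * \<kappa> i + inverse a\<close>.\<close>
  have "\<theta> i * \<kappa> i = p * (\<kappa> i * \<theta> i) + (1 - p) * (a * (\<kappa> i * \<kappa> i) + inverse a)"
    using \<kappa>_nonzero[of i] by (simp add: \<theta>_eq[OF i] algebra_simps)
  then have "(\<theta> i * \<kappa> i) *s u = (p * (\<kappa> i * \<theta> i) + (1 - p) * (a * (\<kappa> i * \<kappa> i) + inverse a)) *s u"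
    by simp
  then show "K (A u) = p *s A (K u) + (1 - p) *s (a *s K (K u) + inverse a *s u)"
    by (simp add: Au K_U[OF i u] Kw algebra_simps)
qed

text \<open>Here \<open>As - \<theta>s i\<close> maps \<open>U i\<close> into the previous summand,
  where \<open>K\<close> has the scalar \<open>r * \<kappa> i\<close>, or to zero if
  \<open>i = 0\<close>.\<close>

lemma K_As: "K (As v) = r *s As (K v)
  - ((r - 1) * b) *s (K (K v) + (inverse b * inverse b) *s v)"
proof (rule split_linear_eq[where X = "\<lambda>v. K (As v)"
      and Y = "\<lambda>v. r *s As (K v) - ((r - 1) * b) *s (K (K v) + (inverse b * inverse b) *s v)"])
  note [simp] = lin_As[THEN E.lin_add] lin_As[THEN E.lin_scale] lin_K[THEN E.lin_add] lin_K[THEN E.lin_scale]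
  show "E.lin (\<lambda>v. K (As v))"
    by (rule E.linI) simp_all
  show "E.lin (\<lambda>v. r *s As (K v) - ((r - 1) * b) *s (K (K v) + (inverse b * inverse b) *s v))"
    by (rule E.linI) (simp_all add: algebra_simps)
  fix i u assume i: "i \<le> d" and u: "u \<in> U i"
  define w where "w = As u - \<theta>s i *s u"
  have Au: "As u = \<theta>s i *s u + w" by (simp add: w_def)
  have w: "w \<in> F i \<inter> G (i - 1)" using As_FG[OF u] by (simp add: w_def)
  have Kw: "K w = (r * \<kappa> i) *s w"
  proof (cases i)
    case 0
    then have "w = 0" using w by (simp add: Es.below_0)
    then show ?thesis by (simp add: E.lin_zero lin_K)
  next
    case (Suc k)
    then show ?thesis using K_U[of k w] w i by (simp add: \<kappa>_pred[of k])
  qed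
  have "\<theta>s i * \<kappa> i = r * (\<kappa> i * \<theta>s i) - ((r - 1) * b) * (\<kappa> i * \<kappa> i + inverse b * inverse b)"
    using \<kappa>_nonzero[of i] b_nonzero by (simp add: \<theta>s_eq[OF i] field_simps)
  then have "(\<theta>s i * \<kappa> i) *s u
    = (r * (\<kappa> i * \<theta>s i) - ((r - 1) * b) * (\<kappa> i * \<kappa> i + inverse b * inverse b)) *s u"
    by simp
  then show "K (As u) = r *s As (K u) - ((r - 1) * b) *s (K (K u) + (inverse b * inverse b) *s u)"
    by (simp add: Au K_U[OF i u] Kw algebra_simps)
qed

section \<open>The action of \<open>K\<close> on the flags \<open>F\<close> and
  \<open>G\<close>\<close>

lemma K_F: "n \<le> Suc d \<Longrightarrow> v \<in> F n \<Longrightarrow> K v \<in> F n"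
proof (induction n arbitrary: v)
  case 0
  then show ?case by (simp add: Es.below_0 E.lin_zero lin_K)
next
  case (Suc i)
  then obtain u where u: "u \<in> U i" "v - u \<in> F i" using F_split by (metis Suc_le_mono)
  then have "K (v - u) \<in> F (Suc i)" using Suc Es.below_mono[of i "Suc i"] by auto
  moreover have "K u \<in> F (Suc i)"
    using K_U[of i u] u Suc.prems by (auto intro: E.subspace_scale Es.subspace_below)
  ultimately have "K (v - u) + K u \<in> F (Suc i)" by (rule E.subspace_add[OF Es.subspace_below])
  then show ?case by (simp add: E.lin_diff lin_K)
qed

text \<open>Modulo \<open>F i\<close> a vector of \<open>F (Suc i)\<close> comes from
  \<open>U i\<close>, where \<open>K\<close> is the scalar \<open>\<kappa> i\<close>, and
  \<open>K\<close> preserves \<open>F i\<close>.\<close>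

lemma K_F_graded:
  assumes "i \<le> d" "v \<in> F (Suc i)"
  shows "K v - \<kappa> i *s v \<in> F i"
proof -
  obtain u where u: "u \<in> U i" "v - u \<in> F i" using F_split assms by blast
  have "K v - \<kappa> i *s v = K (v - u) - \<kappa> i *s (v - u)"
    using K_U[OF assms(1) u(1)] by (simp add: E.lin_diff lin_K algebra_simps)
  also have "\<dots> \<in> F i"
    by (rule E.subspace_diff[OF Es.subspace_below K_F E.subspace_scale[OF Es.subspace_below]])
      (use u assms in auto)
  finally show ?thesis .
qed

text \<open>The index \<open>Suc d - n\<close> lets the induction start at \<open>G (Suc d)\<close>,
  which is zero, and enlarge the space step by step.\<close>

lemma K_G: "v \<in> G (Suc d - n) \<Longrightarrow> K v \<in> G (Suc d - n)"
proof (induction n arbitrary: v)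
  case 0
  then show ?case by (simp add: E.above_top E.lin_zero lin_K)
next
  case (Suc m)
  show ?case
  proof (cases "m \<le> d")
    case True
    define i where "i = d - m"
    have i: "Suc d - m = Suc i" "Suc d - Suc m = i" "i \<le> d" using True by (auto simp: i_def)
    obtain u where u: "u \<in> U i" "v - u \<in> G (Suc i)" using G_split Suc.prems i by metis
    then have "K (v - u) \<in> G i" using Suc.IH E.above_antimono[of i "Suc i"] i by fastforce
    moreover have "K u \<in> G i"
      using K_U[of i u] u i by (auto intro: E.subspace_scale E.subspace_above)
    ultimately have "K (v - u) + K u \<in> G i" by (rule E.subspace_add[OF E.subspace_above])
    then have "K v \<in> G i" by (simp add: E.lin_diff lin_K)
    then show ?thesis using i(2) by simp
  qed (simp add: E.above_0)
qed

lemma K_G_graded: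
  assumes "i \<le> d" "v \<in> G i"
  shows "K v - \<kappa> i *s v \<in> G (Suc i)"
proof -
  obtain u where u: "u \<in> U i" "v - u \<in> G (Suc i)" using G_split assms by blast
  have "K v - \<kappa> i *s v = K (v - u) - \<kappa> i *s (v - u)"
    using K_U[OF assms(1) u(1)] by (simp add: E.lin_diff lin_K algebra_simps)
  also have "\<dots> \<in> G (Suc i)"
  proof (rule E.subspace_diff[OF E.subspace_above _ E.subspace_scale[OF E.subspace_above u(2)]])
    have "Suc d - (d - i) = Suc i" using assms(1) by simp
    then show "K (v - u) \<in> G (Suc i)" using K_G[of "v - u" "d - i"] u(2) by simp
  qed
  finally show ?thesis .
qed

text \<open>On \<open>G j\<close> modulo \<open>G (Suc j)\<close> the map
  \<open>K - \<kappa> n\<close> is the scalar \<open>\<kappa> j - \<kappa> n\<close>, nonzero for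
  \<open>j < n\<close>. So \<open>y\<close> climbs from \<open>G 0\<close> to
  \<open>G n\<close>.\<close>

lemma G_of_K_shift:
  assumes "n \<le> d" "K y - \<kappa> n *s y \<in> G n"
  shows "y \<in> G n"
proof -
  have "j \<le> n \<Longrightarrow> y \<in> G j" for j
  proof (induction j)
    case 0
    then show ?case by (simp add: E.above_0)
  next
    case (Suc j)
    then have "K y - \<kappa> j *s y \<in> G (Suc j)" using K_G_graded assms by auto
    moreover have "K y - \<kappa> n *s y \<in> G (Suc j)"
      using assms(2) E.above_antimono[OF Suc.prems] by blast
    ultimately have "(K y - \<kappa> j *s y) - (K y - \<kappa> n *s y) \<in> G (Suc j)"
      by (rule E.subspace_diff[OF E.subspace_above])
    moreover have "(K y - \<kappa> j *s y) - (K y - \<kappa> n *s y) = (\<kappa> n - \<kappa> j) *s y"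
      by (simp add: E.scale_left_diff_distrib)
    ultimately have "(\<kappa> n - \<kappa> j) *s y \<in> G (Suc j)" by simp
    from E.subspace_scale[OF E.subspace_above this, of "inverse (\<kappa> n - \<kappa> j)"]
    have "inverse (\<kappa> n - \<kappa> j) *s (\<kappa> n - \<kappa> j) *s y \<in> G (Suc j)" .
    moreover have "\<kappa> n - \<kappa> j \<noteq> 0" using \<kappa>_inj[of n j] Suc.prems assms(1) by auto
    then have "inverse (\<kappa> n - \<kappa> j) *s (\<kappa> n - \<kappa> j) *s y = y" by (simp add: E.scale_scale)
    ultimately show ?case by (rule subst[of _ _ "\<lambda>y. y \<in> G (Suc j)", rotated])
  qed
  then show ?thesis by simp
qed

end

section \<open>The maps M and D\<close>

text \<open>\<open>B\<close> enters only through relations, those of \<open>K\<close> for the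
  reversed order, where \<open>a\<close> is inverted. Thus the same results apply with
  \<open>K\<close> and \<open>B\<close> exchanged.\<close>

locale q_racah_pair = q_racah_split scale d E Es A As \<theta> \<theta>s q a b \<kappa>
  for scale :: "'a::field \<Rightarrow> 'b::ab_group_add \<Rightarrow> 'b" (infixr \<open>*s\<close> 75)
    and d E Es A As \<theta> \<theta>s q a b \<kappa> +
  fixes B :: "'b \<Rightarrow> 'b"
  assumes lin_B: "E.lin B"
    and B_A: "B (A v) = p *s A (B v) + (1 - p) *s (inverse a *s B (B v) + a *s v)"
    and B_As: "B (As v) = r *s As (B v) - ((r - 1) * b) *s (B (B v) + (inverse b * inverse b) *s v)"
    and B_F_graded: "i \<le> d \<Longrightarrow> v \<in> F (Suc i) \<Longrightarrow> B v - \<kappa> i *s v \<in> F i"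
begin

definition M :: "'b \<Rightarrow> 'b" where
  "M v = inverse (a - inverse a) *s (a *s K v - inverse a *s B v)"

definition D :: "'b \<Rightarrow> 'b" where
  "D v = K v - M v"

lemma lin_M: "E.lin M"
  unfolding M_def by (rule E.linI) (simp_all add: E.lin_add E.lin_scale lin_K lin_B algebra_simps)

lemma lin_D: "E.lin D"
  unfolding D_def by (rule E.linI) (simp_all add: E.lin_add E.lin_scale lin_K lin_M algebra_simps)

lemma a_diff: "a - inverse a \<noteq> 0" and a_square_diff: "1 - a * a \<noteq> 0"
  using a_nonzero a_square by (auto simp: field_simps)

lemma K_eq: "K v = M v + D v"
  by (simp add: D_def)

lemma B_eq: "B v = M v + (a * a) *s D v"
proof -
  have "(a - inverse a) *s M v = a *s K v - inverse a *s B v"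
    using a_diff by (simp add: M_def)
  then have "inverse a *s B v = a *s K v - (a - inverse a) *s M v"
    by (simp only: diff_diff_eq2 add_diff_cancel_left')
  then have "a *s (inverse a *s B v) = a *s (a *s K v - (a - inverse a) *s M v)"
    by (rule arg_cong)
  then show ?thesis using a_nonzero by (simp add: D_def algebra_simps)
qed

lemma M_combination: "(1 - a * a) *s M v = B v - (a * a) *s K v"
  and D_combination: "(1 - a * a) *s D v = K v - B v"
  by (simp_all add: K_eq B_eq algebra_simps)

lemma cancel_a_square: "(1 - a * a) *s x = (1 - a * a) *s y \<Longrightarrow> x = y"
  using a_square_diff by simp

lemma scalar_simps: "a * inverse a = 1" "inverse a * a = 1" "a * (inverse a * x) = x" "inverse a * (a * x) = x"
  using a_nonzero by (simp_all add: mult.assoc[symmetric])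

lemmas lin_simps = E.lin_add[OF lin_M] E.lin_add[OF lin_D] E.lin_add[OF lin_A] E.lin_add[OF lin_As]
  E.lin_scale[OF lin_M] E.lin_scale[OF lin_D] E.lin_scale[OF lin_A] E.lin_scale[OF lin_As]

text \<open>After multiplication by \<open>1 - a * a\<close>, both \<open>M\<close> and
  \<open>D\<close> are combinations of \<open>K\<close> and \<open>B\<close>. Combining the
  relations of these two and rewriting them in \<open>M\<close> and \<open>D\<close> gives this
  relation and the next three.\<close>

lemma D_A: "D (A v) = p *s A (D v) + (1 - p) *s (a *s D (D v) + inverse a *s v - inverse a *s M (M v))"
  by (rule cancel_a_square, unfold D_combination K_A B_A)
    (simp add: K_eq B_eq lin_simps scalar_simps algebra_simps del: right_inverse left_inverse)

lemma M_A: "M (A v) = p *s A (M v) + (1 - p) *s ((a + inverse a) *s M (M v) + a *s (M (D v) + D (M v)))"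
  by (rule cancel_a_square, unfold M_combination K_A B_A)
    (simp add: K_eq B_eq lin_simps scalar_simps algebra_simps del: right_inverse left_inverse)

lemma D_As: "D (As v) = r *s As (D v)
    - ((r - 1) * b) *s (M (D v) + D (M v) + (1 + a * a) *s D (D v))"
  by (rule cancel_a_square, unfold D_combination K_As B_As)
    (simp add: K_eq B_eq lin_simps scalar_simps algebra_simps del: right_inverse left_inverse)

lemma M_As: "M (As v) = r *s As (M v)
    - ((r - 1) * b) *s (M (M v) - (a * a) *s D (D v) + (inverse b * inverse b) *s v)"
  by (rule cancel_a_square, unfold M_combination K_As B_As)
    (simp add: K_eq B_eq lin_simps scalar_simps algebra_simps del: right_inverse left_inverse)

lemma M_F_graded:
  assumes "i \<le> d" "v \<in> F (Suc i)"
  shows "M v - \<kappa> i *s v \<in> F i"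
proof -
  have "inverse (1 - a * a) *s ((B v - \<kappa> i *s v) - (a * a) *s (K v - \<kappa> i *s v)) \<in> F i"
    by (intro E.subspace_scale E.subspace_diff Es.subspace_below B_F_graded K_F_graded assms)
  moreover have "(B v - \<kappa> i *s v) - (a * a) *s (K v - \<kappa> i *s v) = (1 - a * a) *s (M v - \<kappa> i *s v)"
    using M_combination[of v] by (simp add: algebra_simps)
  ultimately show ?thesis using a_square_diff by simp
qed

text \<open>\<open>K\<close> and \<open>M\<close> act on \<open>F (Suc i)\<close> modulo
  \<open>F i\<close> by the same scalar, so their difference acts as zero there.\<close>

lemma D_F:
  assumes "i \<le> d" "v \<in> F (Suc i)"
  shows "D v \<in> F i"
  using E.subspace_diff[OF Es.subspace_below K_F_graded[OF assms] M_F_graded[OF assms]]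
  by (simp add: D_def)

lemma M_F: "n \<le> Suc d \<Longrightarrow> v \<in> F n \<Longrightarrow> M v \<in> F n"
proof (cases n)
  case 0
  then show "v \<in> F n \<Longrightarrow> M v \<in> F n" by (simp add: Es.below_0 E.lin_zero lin_M)
next
  case (Suc i)
  assume "n \<le> Suc d" "v \<in> F n"
  then have "M v - \<kappa> i *s v \<in> F n" "\<kappa> i *s v \<in> F n"
    using Suc M_F_graded[of i v] Es.below_mono[of i n] by (auto intro: E.subspace_scale Es.subspace_below)
  from E.subspace_add[OF Es.subspace_below this] show ?thesis by simp
qed

lemma M_D: "M (D v) = r *s D (M v)"
proof -
  define Z where "Z v = M (D v) - r *s D (M v)" for v
  define W where "W = E.jointly_invariant M D hull range Z"
  note subs = E.subspace_add E.subspace_diff E.subspace_scale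
  have pr: "p * r = 1" using q_nonzero by (simp add: field_simps)
  have ZA: "Z (A v) = (p * p) *s A (Z v) + (1 - p) *s ((a + inverse a) *s (p *s M (Z v) + Z (M v))
      + (a * (1 + p)) *s (Z (D v) + D (Z v)))" for v
    by (rule E.cross_relation_lower[where M = M and D = D and Z = Z, OF lin_A lin_M lin_D pr D_A M_A Z_def])
  have ZAs: "Z (As v) = (r * r) *s As (Z v) - ((r - 1) * b) *s ((1 + r) *s (M (Z v) + Z (M v))
      + (1 + a * a) *s (Z (D v) + r *s D (Z v)))" for v
    by (rule E.cross_relation_raise[where M = M and D = D and Z = Z, OF lin_As lin_M lin_D D_As M_As Z_def])
  have inv: "A w \<in> W" if "w \<in> W" for w
    using that unfolding W_def
  proof (rule E.jointly_invariant_hull_invariant[OF lin_A lin_M lin_D, rotated -1])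
    show "p \<noteq> 0" "p * p \<noteq> 0" using q_nonzero by simp_all
  next
    fix S v assume "E.jointly_invariant M D S"
    then have S: "E.subspace S \<and> (\<forall>x\<in>S. M x \<in> S \<and> D x \<in> S)" by (simp add: E.jointly_invariant_def)
    { assume "v \<in> S"
      then show "M (A v) - p *s A (M v) \<in> S" "D (A v) - p *s A (D v) \<in> S"
        \<comment> \<open>After the leading term cancels, only words in \<open>M\<close> and
          \<open>D\<close> applied to \<open>v\<close> remain, and these stay in
          \<open>S\<close>.\<close>
        unfolding M_A D_A add_diff_cancel_left' using S by (auto intro!: subs) }
    { assume "range Z \<subseteq> S"
      then show "Z (A v) - (p * p) *s A (Z v) \<in> S"
        \<comment> \<open>Each remaining word contains \<open>Z\<close>; whatever stands to its left
          is \<open>M\<close> or \<open>D\<close>, which preserves \<open>S\<close>.\<close>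
        unfolding ZA add_diff_cancel_left' using S by (auto intro!: subs) }
  qed
  have invs: "As w \<in> W" if "w \<in> W" for w
    using that unfolding W_def
  proof (rule E.jointly_invariant_hull_invariant[OF lin_As lin_M lin_D, rotated -1])
    show "r \<noteq> 0" "r * r \<noteq> 0" using q_nonzero by simp_all
  next
    fix S v assume "E.jointly_invariant M D S"
    then have S: "E.subspace S \<and> (\<forall>x\<in>S. M x \<in> S \<and> D x \<in> S)" by (simp add: E.jointly_invariant_def)
    { assume "v \<in> S"
      then show "M (As v) - r *s As (M v) \<in> S" "D (As v) - r *s As (D v) \<in> S"
        unfolding M_As D_As using S by (auto intro!: subs E.subspace_neg) }
    { assume "range Z \<subseteq> S"
      then show "Z (As v) - (r * r) *s As (Z v) \<in> S"
        unfolding ZAs using S by (auto intro!: subs E.subspace_neg) }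
  qed
  \<comment> \<open>Since \<open>F (Suc d)\<close> is all of V, one lowering step already puts the
    range of \<open>D\<close> into \<open>F d\<close>.\<close>
  have D_top: "D x \<in> F d" for x
    using D_F[of d x] by (simp add: Es.below_top)
  have "W \<subseteq> F d"
    unfolding W_def
  proof (rule hull_minimal)
    show "E.jointly_invariant M D (F d)" using M_F[of d] D_top by (simp add: E.jointly_invariant_def Es.subspace_below)
    show "range Z \<subseteq> F d" unfolding Z_def using D_top M_F[of d] by (auto intro!: subs Es.subspace_below)
  qed
  moreover have "E.subspace W"
    unfolding W_def using E.jointly_invariant_hull by (simp add: E.jointly_invariant_def)
  ultimately have "W = {0}" using irreducible[OF _ inv invs] F_neq_UNIV by blast
  moreover have "Z v \<in> W" unfolding W_def by (rule hull_inc) simp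
  ultimately show ?thesis by (simp add: Z_def)
qed

lemma bij_M: "bij M"
proof (rule bijI)
  \<comment> \<open>\<open>M\<close> is triangular along the flag \<open>F\<close> with nonzero
    diagonal scalars \<open>\<kappa> i\<close>. A kernel vector therefore descends through the whole
    flag, down to \<open>F 0\<close>.\<close>
  have "n \<le> Suc d \<Longrightarrow> M v = 0 \<Longrightarrow> v \<in> F (Suc d - n)" for v n
  proof (induction n)
    case 0
    then show ?case by (simp add: Es.below_top)
  next
    case (Suc n)
    define i where "i = d - n"
    have i: "Suc d - n = Suc i" "Suc d - Suc n = i" "i \<le> d" using Suc.prems by (auto simp: i_def)
    then have "(- inverse (\<kappa> i)) *s (M v - \<kappa> i *s v) \<in> F i"
      using Suc M_F_graded[of i v] by (intro E.subspace_scale Es.subspace_below) auto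
    then have "v \<in> F i" using Suc.prems \<kappa>_nonzero by simp
    then show ?case by (simp only: i)
  qed
  from this[of "Suc d"] have "M v = 0 \<Longrightarrow> v = 0" for v by (simp add: Es.below_0)
  then have "M (x - y) = 0 \<Longrightarrow> x - y = 0" for x y by blast
  then show "inj M" by (intro injI) (simp add: E.lin_diff lin_M)
  have "n \<le> Suc d \<Longrightarrow> v \<in> F n \<Longrightarrow> \<exists>y. M y = v" for v n
  proof (induction n arbitrary: v)
    case 0
    then show ?case using E.lin_zero[OF lin_M] by (auto simp: Es.below_0)
  next
    case (Suc i)
    then obtain y where "M y = M v - \<kappa> i *s v" using M_F_graded[of i v] by auto
    \<comment> \<open>Preimages are built upwards: the choice of \<open>y\<close> gives
      \<open>M (v - y) = \<kappa> i *s v\<close>.\<close>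
    then have "M (inverse (\<kappa> i) *s (v - y)) = v"
      using \<kappa>_nonzero[of i] by (simp add: E.lin_scale E.lin_diff lin_M)
    then show ?case by blast
  qed
  from this[of "Suc d"] show "surj M" by (auto simp: Es.below_top surj_def) metis
qed

text \<open>Descending induction on \<open>i\<close>: the part of \<open>M y\<close> in
  \<open>G (Suc i)\<close> is handled by the previous step, and the part in \<open>U i\<close> by
  \<open>M_D\<close> together with \<open>G_of_K_shift\<close>.\<close>

lemma M_inverse_G:
  assumes "M y \<in> G i"
  shows "y \<in> G (i - 1)"
proof -
  \<comment> \<open>Here \<open>Suc d - n\<close> plays the role of \<open>i\<close>, and
    \<open>d - n\<close> that of \<open>i - 1\<close>; the bound \<open>n \<le> d\<close> keeps
    \<open>i\<close> positive.\<close>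
  have main: "n \<le> d \<Longrightarrow> M y \<in> G (Suc d - n) \<Longrightarrow> y \<in> G (d - n)" for n y
  proof (induction n arbitrary: y)
    case 0
    then have "M y = M 0" by (simp add: E.above_top E.lin_zero lin_M)
    then have "y = 0" using bij_M by (auto dest: bij_is_inj injD)
    then show ?case by (simp add: E.subspace_0 E.subspace_above)
  next
    case (Suc m)
    define i where "i = d - m"
    have i: "Suc d - m = Suc i" "Suc d - Suc m = i" "i \<le> d" "d - Suc m = i - 1" "0 < i" "d - m = i"
      using Suc.prems by (auto simp: i_def)
    obtain u where u: "u \<in> U i" "M y - u \<in> G (Suc i)" using G_split Suc.prems i by metis
    obtain y' where y': "M y' = u" using bij_M by (metis bij_pointE)
    have "y - y' \<in> G i" using Suc.IH[of "y - y'"] Suc.prems u y' by (simp add: i E.lin_diff lin_M)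
    then have diff: "y - y' \<in> G (i - 1)" using E.above_antimono[of "i - 1" i] by auto
    have \<kappa>: "\<kappa> (i - 1) = r * \<kappa> i" using \<kappa>_pred[of "i - 1"] i by simp
    \<comment> \<open>This is \<open>M_D\<close> at \<open>y'\<close> with \<open>D = K - M\<close>,
      using that \<open>K\<close> acts on \<open>u = M y'\<close> as
      \<open>\<kappa> i\<close>.\<close>
    have "M (K y') = M ((r * \<kappa> i) *s y' - (r - 1) *s u)"
      using M_D[of y'] K_U[OF i(3) u(1)]
      by (simp add: D_def E.lin_add E.lin_diff E.lin_scale lin_M y' algebra_simps)
    then have "K y' = (r * \<kappa> i) *s y' - (r - 1) *s u" using bij_M by (auto dest: bij_is_inj injD)
    then have "K y' - \<kappa> (i - 1) *s y' = (1 - r) *s u"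
      unfolding \<kappa> by (simp add: algebra_simps)
    \<comment> \<open>The right-hand side above is a multiple of \<open>u\<close>, so
      \<open>K - \<kappa> (i - 1)\<close> sends \<open>y'\<close> into
      \<open>G (i - 1)\<close>.\<close>
    moreover have "u \<in> G (i - 1)" using u(1) E.above_antimono[of "i - 1" i] by auto
    ultimately have "y' \<in> G (i - 1)"
      using G_of_K_shift[of "i - 1" y'] i by (simp add: E.subspace_scale E.subspace_above)
    from E.subspace_add[OF E.subspace_above this diff] show ?case by (simp add: i)
  qed
  show ?thesis
  proof (cases "i = 0 \<or> d < i")
    case True
    then show ?thesis
    proof
      assume "d < i"
      then have "M y = M 0" using assms by (simp add: E.above_top E.lin_zero lin_M)
      then have "y = 0" using bij_M by (auto dest: bij_is_inj injD)
      then show ?thesis by (simp add: E.subspace_0 E.subspace_above)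
    qed (simp add: E.above_0)
  next
    case False
    then have e: "Suc d - i \<le> d" "Suc d - (Suc d - i) = i" "d - (Suc d - i) = i - 1" by auto
    show ?thesis using main[OF e(1), unfolded e(2,3), OF assms] .
  qed
qed

end

section \<open>TD systems of q-Racah type\<close>

context td_space
begin

lemma padded_kernel:
  assumes "\<And>i j v. i \<le> d \<Longrightarrow> j \<le> d \<Longrightarrow> i \<noteq> j \<Longrightarrow> P j (P i v) = 0" "lin (P j)" "j \<le> d"
    and "m \<noteq> int j" "x \<in> padded d (\<lambda>i. range (P i)) m"
  shows "P j x = 0"
proof (cases "0 \<le> m \<and> m \<le> int d")
  case True
  then obtain v where "x = P (nat m) v" using assms(5) by (auto simp: padded_def)
  then show ?thesis using assms(1)[of "nat m" j v] True assms(3,4) by auto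
next
  case False
  then show ?thesis using assms by (auto simp: padded_def lin_zero)
qed

text \<open>Translates the data of one map of a TD system into the locale form. Completeness comes
  from an eigenbasis, and the eigenvalues differ because the listed eigenspaces do.\<close>

lemma primitive_idempotents:
  assumes linX: "lin X" and diag: "diagonalizable X"
    and primitive: "\<forall>i\<le>d. primitive_idempotent X (range (P i)) (P i)"
    and std: "standard_ordering X Y d (\<lambda>i. range (P i))"
  defines "\<theta> \<equiv> \<lambda>i. eigenvalue_on X (range (P i))"
  shows "idempotent_resolution scale d P"
    and "i \<le> d \<Longrightarrow> X (P i v) = \<theta> i *s P i v"
    and "lin Y \<Longrightarrow> i \<le> d \<Longrightarrow> j \<le> d \<Longrightarrow> i + 1 < j \<or> j + 1 < i \<Longrightarrow> P j (Y (P i v)) = 0"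
    and "i \<le> d \<Longrightarrow> \<exists>v. P i v \<noteq> 0"
    and "i \<le> d \<Longrightarrow> j \<le> d \<Longrightarrow> i \<noteq> j \<Longrightarrow> \<theta> i \<noteq> \<theta> j"
proof -
  note prim = primitive[rule_format]
  have bij: "bij_betw (\<lambda>i. range (P i)) {0..d} (eigenspaces X)"
    using std by (simp add: standard_ordering_def)
  then have neq: "range (P i) \<noteq> range (P j)" if "i \<le> d" "j \<le> d" "i \<noteq> j" for i j
    using that by (auto dest!: bij_betw_imp_inj_on simp: inj_on_def)
  have linP: "lin (P i)" if "i \<le> d" for i
    using prim[OF that] by (simp add: primitive_idempotent_def)
  have orth: "P i w = 0" if "i \<le> d" "j \<le> d" "i \<noteq> j" "w \<in> range (P j)" for i j w
  proof -
    have "range (P j) \<in> eigenspaces X" using prim[OF that(2)] by (simp add: primitive_idempotent_def)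
    moreover have "range (P j) \<noteq> range (P i)" using neq[OF that(2,1)] that(3) by blast
    moreover have "\<forall>W\<in>eigenspaces X. W \<noteq> range (P i) \<longrightarrow> (\<forall>v\<in>W. P i v = 0)"
      using prim[OF that(1)] by (simp add: primitive_idempotent_def)
    ultimately show ?thesis using that(4) by blast
  qed
  have P_id: "P i w = w" if "i \<le> d" "w \<in> range (P i)" for i w
    using prim[OF that(1)] that(2) unfolding primitive_idempotent_def by blast
  have space: "range (P i) = eigenspace X (\<theta> i) \<and> range (P i) \<noteq> {0}" if "i \<le> d" for i
  proof -
    have "range (P i) \<in> eigenspaces X" using prim[OF that] by (simp add: primitive_idempotent_def)
    then obtain t where t: "range (P i) = eigenspace X t" "eigenspace X t \<noteq> {0}"
      unfolding eigenspaces_def by blast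
    have "0 \<in> range (P i)" using lin_zero[OF linP[OF that]] by (metis rangeI)
    \<comment> \<open>A nonzero vector of the eigenspace determines the scalar in the definite
      description \<open>eigenvalue_on\<close>.\<close>
    then obtain w where w: "w \<in> range (P i)" "w \<noteq> 0" using t by blast
    have all: "\<forall>v\<in>range (P i). X v = t *s v" unfolding t(1) by (simp add: eigenspace_def)
    have "\<theta> i = t"
      unfolding \<theta>_def eigenvalue_on_def
    proof (rule the_equality)
      show "\<forall>v\<in>range (P i). X v = t *s v" by (rule all)
      fix t' assume "\<forall>v\<in>range (P i). X v = t' *s v"
      then have "t' *s w = t *s w" using w(1) all by metis
      then show "t' = t" using w(2) by simp
    qed
    then show ?thesis using t by simp
  qed
  show "X (P i v) = \<theta> i *s P i v" if "i \<le> d" for i v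
  proof -
    have "P i v \<in> eigenspace X (\<theta> i)" using space[OF that] by blast
    then show ?thesis by (simp add: eigenspace_def)
  qed
  show "\<theta> i \<noteq> \<theta> j" if "i \<le> d" "j \<le> d" "i \<noteq> j" for i j
  proof
    assume eq: "\<theta> i = \<theta> j"
    have "range (P i) = eigenspace X (\<theta> j)" unfolding eq[symmetric] using space[OF that(1)] ..
    moreover have "range (P j) = eigenspace X (\<theta> j)" using space[OF that(2)] ..
    ultimately show False using neq[OF that] by blast
  qed
  show "\<exists>v. P i v \<noteq> 0" if "i \<le> d" for i
  proof (rule ccontr)
    assume "\<not> (\<exists>v. P i v \<noteq> 0)"
    then have "range (P i) = {0}" by auto
    then show False using space[OF that] by simp
  qed
  show "P j (Y (P i v)) = 0" if "lin Y" "i \<le> d" "j \<le> d" "i + 1 < j \<or> j + 1 < i" for i j v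
  proof -
    have "Y (P i v) \<in> neighbour_sum d (\<lambda>i. range (P i)) i"
      using std \<open>i \<le> d\<close> unfolding standard_ordering_def by blast
    then obtain x y z where xyz: "Y (P i v) = x + y + z"
      "x \<in> padded d (\<lambda>i. range (P i)) (int i - 1)" "y \<in> padded d (\<lambda>i. range (P i)) (int i)"
      "z \<in> padded d (\<lambda>i. range (P i)) (int i + 1)"
      by (auto simp: neighbour_sum_def elim!: set_plus_elim)
    have "P j u = 0" if "u \<in> padded d (\<lambda>i. range (P i)) m" "m \<noteq> int j" for u m
    proof (rule padded_kernel[where P = P and d = d and m = m])
      show "P j (P i v) = 0" if "i \<le> d" "j \<le> d" "i \<noteq> j" for i j v
        by (rule orth[OF that(2,1) that(3)[symmetric] rangeI])
    qed (use linP \<open>j \<le> d\<close> that in auto)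
    then have "P j x = 0" "P j y = 0" "P j z = 0" using xyz(2-4) that(4) by auto
    then show ?thesis using lin_add[OF linP[OF that(3)]] by (simp add: xyz(1))
  qed
  show "idempotent_resolution scale d P"
  proof (intro idempotent_resolution.intro[OF td_space_axioms] idempotent_resolution_axioms.intro)
    show "lin (P i)" if "i \<le> d" for i by (rule linP[OF that])
    show "P i (P j v) = 0" if "i \<le> d" "j \<le> d" "i \<noteq> j" for i j v by (rule orth[OF that rangeI])
    fix v
    obtain B where B: "independent B" "span B = UNIV" "\<And>b. b \<in> B \<Longrightarrow> \<exists>t. X b = t *s b"
      using diag by (auto simp: diagonalizable_def)
    have "v \<in> span B" using B by simp
    \<comment> \<open>Both sides are linear in \<open>v\<close>, so an eigenbasis suffices; each of
      its vectors lies in exactly one of the listed eigenspaces.\<close>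
    then show "(\<Sum>i\<le>d. P i v) = v"
    proof (induction rule: span_induct)
      have "lin (\<lambda>v. \<Sum>i\<le>d. P i v)"
      proof (rule linI)
        show "(\<Sum>i\<le>d. P i (x + y)) = (\<Sum>i\<le>d. P i x) + (\<Sum>i\<le>d. P i y)" for x y
          unfolding sum.distrib[symmetric] by (rule sum.cong) (use lin_add[OF linP] in auto)
        show "(\<Sum>i\<le>d. P i (c *s x)) = c *s (\<Sum>i\<le>d. P i x)" for c x
          unfolding scale_sum_right by (rule sum.cong) (use lin_scale[OF linP] in auto)
      qed
      from lin_add[OF this] lin_scale[OF this] lin_zero[OF this]
      show "subspace {v. (\<Sum>i\<le>d. P i v) = v}" by (simp add: subspace_def)
      fix b assume b: "b \<in> B"
      then obtain t where t: "X b = t *s b" using B by blast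
      have "b \<noteq> 0" using B(1) b dependent_zero by blast
      then have "eigenspace X t \<in> eigenspaces X" "b \<in> eigenspace X t"
        using t by (auto simp: eigenspaces_def eigenspace_def)
      then have "eigenspace X t \<in> (\<lambda>i. range (P i)) ` {0..d}" "b \<in> eigenspace X t"
        unfolding bij_betw_imp_surj_on[OF bij] by blast+
      then obtain k where k: "k \<le> d" "b \<in> range (P k)" by force
      have "(\<Sum>i\<le>d. P i b) = (\<Sum>i\<le>d. if i = k then b else 0)"
      proof (rule sum.cong)
        fix i assume i: "i \<in> {..d}"
        show "P i b = (if i = k then b else 0)"
        proof (cases "i = k")
          case True
          then show ?thesis using P_id[OF k] by simp
        next
          case False
          then have "P i b = 0" using i by (intro orth[OF _ k(1) _ k(2)]) auto
          then show ?thesis using False by simp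
        qed
      qed simp
      then show "(\<Sum>i\<le>d. P i b) = b" using k by simp
    qed
  qed
qed

lemma td_system_imp_split_system:
  assumes "td_system d A E As Es"
  shows "split_system scale d E Es A As (\<lambda>i. eigenvalue_on A (range (E i)))
    (\<lambda>i. eigenvalue_on As (range (Es i)))"
proof -
  have A: "lin A" "lin As" "diagonalizable A" "diagonalizable As"
    and irr: "\<not> (\<exists>W. subspace W \<and> W \<noteq> {0} \<and> W \<noteq> UNIV \<and> A ` W \<subseteq> W \<and> As ` W \<subseteq> W)"
    and prim: "\<forall>i\<le>d. primitive_idempotent A (range (E i)) (E i)"
      "\<forall>i\<le>d. primitive_idempotent As (range (Es i)) (Es i)"
    and std: "standard_ordering A As d (\<lambda>i. range (E i))" "standard_ordering As A d (\<lambda>i. range (Es i))"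
    using assms by (auto simp: td_system_def td_pair_def)
  note E = primitive_idempotents[OF A(1,3) prim(1) std(1)]
  note Es = primitive_idempotents[OF A(2,4) prim(2) std(2)]
  show ?thesis
  proof (intro split_system.intro split_system_axioms.intro)
    fix W assume "subspace W" "\<And>w. w \<in> W \<Longrightarrow> A w \<in> W" "\<And>w. w \<in> W \<Longrightarrow> As w \<in> W"
    then show "W = {0} \<or> W = UNIV" using irr by blast
  qed (fact A E(1) Es(1) | erule E(2,4) Es(2,4) | erule (2) E(3)[OF A(2)] Es(3)[OF A(1)])+
qed

end

section \<open>Reversing the order of the eigenspaces of \<open>A\<close>\<close>

lemma (in split_system) reversed:
  "split_system scale d (\<lambda>j. E (d - j)) Es A As (\<lambda>j. \<theta> (d - j)) \<theta>s"
proof (intro split_system.intro split_system_axioms.intro E.reversed)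
  show "idempotent_resolution scale d Es" by (rule Es.idempotent_resolution_axioms)
  show "E (d - j) (As (E (d - i) v)) = 0"
    if "i \<le> d" "j \<le> d" "i + 1 < j \<or> j + 1 < i" for i j v
    using that by (intro As_E) auto
  fix W assume "E.subspace W" "\<And>w. w \<in> W \<Longrightarrow> A w \<in> W" "\<And>w. w \<in> W \<Longrightarrow> As w \<in> W"
  then show "W = {0} \<or> W = UNIV" using irreducible by blast
qed (use lin_A lin_As A_E As_Es A_Es E_nonzero Es_nonzero in auto)

context q_racah_split
begin

text \<open>Since \<open>\<kappa> (d - i) = inverse (\<kappa> i)\<close>, the reversed eigenvalues
  have the same form with \<open>a\<close> inverted. The order of \<open>Es\<close> is kept, so the
  flag \<open>F\<close> is unchanged.\<close>

lemma reversed_q_racah: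
  "q_racah_split scale d (\<lambda>j. E (d - j)) Es A As (\<lambda>j. \<theta> (d - j)) \<theta>s q (inverse a) b \<kappa>"
proof (intro q_racah_split.intro q_racah_split_axioms.intro reversed)
  show "\<theta> (d - i) = inverse a * \<kappa> i + inverse (inverse a) * inverse (\<kappa> i)" if i: "i \<le> d" for i
  proof -
    have "int d - 2 * int (d - i) = - (int d - 2 * int i)" using i by (simp add: of_nat_diff)
    then have "\<kappa> (d - i) = inverse (\<kappa> i)" unfolding \<kappa>_def by (simp only: power_int_minus)
    then show ?thesis by (simp add: \<theta>_eq)
  qed
  show "inverse a * inverse a \<noteq> 1"
    using a_square a_nonzero by (metis inverse_mult_distrib inverse_1 inverse_inverse_eq)
qed (use \<kappa>_def q_nonzero a_nonzero b_nonzero \<kappa>_inj \<theta>s_eq in auto)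

interpretation rev: q_racah_split scale d "\<lambda>j. E (d - j)" Es A As "\<lambda>j. \<theta> (d - j)" \<theta>s q "inverse a" b \<kappa>
  by (rule reversed_q_racah)

text \<open>\<open>rev.K\<close> is the map B of the second split decomposition: \<open>K_A\<close>
  for the reversed order is the required relation with \<open>A\<close>, and the relations with
  \<open>As\<close> and \<open>F\<close> carry over unchanged.\<close>

interpretation pair: q_racah_pair scale d E Es A As \<theta> \<theta>s q a b \<kappa> rev.K
proof (intro q_racah_pair.intro q_racah_pair_axioms.intro q_racah_split_axioms rev.lin_K rev.K_As rev.K_F_graded)
  show "rev.K (A v) = p *s A (rev.K v) + (1 - p) *s (inverse a *s rev.K (rev.K v) + a *s v)" for v
    using rev.K_A[of v] by simp
qed

interpretation rev_pair: q_racah_pair scale d "\<lambda>j. E (d - j)" Es A As "\<lambda>j. \<theta> (d - j)" \<theta>s q "inverse a" b \<kappa> K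
proof (intro q_racah_pair.intro q_racah_pair_axioms.intro reversed_q_racah lin_K K_As K_F_graded)
  show "K (A v) = p *s A (K v) + (1 - p) *s (inverse (inverse a) *s K (K v) + inverse a *s v)" for v
    using K_A[of v] by simp
qed

lemma split_U_eq: "i \<le> d \<Longrightarrow> E.split_U d E Es i = U i"
  unfolding E.split_U_def
  by (subst E.sum_range_eq Es.sum_range_eq, force)+ (auto simp: Es.below_def E.above_def)

lemma split_U_down_eq: "i \<le> d \<Longrightarrow> E.split_U_down d E Es i = rev.U i"
proof -
  assume i: "i \<le> d"
  \<comment> \<open>The substitution of \<open>d - j\<close> for \<open>j\<close> matches the
    indices beyond \<open>d - i\<close> with those below \<open>i\<close>.\<close>
  have "(\<forall>j\<le>d. j \<notin> {0..d - i} \<longrightarrow> E j v = 0) \<longleftrightarrow> (\<forall>j\<le>d. j < i \<longrightarrow> E (d - j) v = 0)" for v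
  proof safe
    fix j assume "\<forall>j\<le>d. j \<notin> {0..d - i} \<longrightarrow> E j v = 0" "j \<le> d" "j < i"
    then show "E (d - j) v = 0" using i by auto
  next
    fix j assume *: "\<forall>j\<le>d. j < i \<longrightarrow> E (d - j) v = 0" "j \<le> d" "j \<notin> {0..d - i}"
    then have "d - j < i" by auto
    with *(1) have "E (d - (d - j)) v = 0" by simp
    then show "E j v = 0" using *(2) by simp
  qed
  then show ?thesis
    unfolding E.split_U_down_def
    by (subst E.sum_range_eq Es.sum_range_eq, use i in force)+ (auto simp: Es.below_def rev.E.above_def)
qed

lemma K_map_eq: "E.K_map d E Es q = K"
  unfolding E.K_map_def E.split_map_def K_def by (simp add: split_U_eq \<kappa>_def cong: conj_cong)

lemma B_map_eq: "E.B_map d E Es q = rev.K"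
  unfolding E.B_map_def E.split_map_def rev.K_def by (simp add: split_U_down_eq \<kappa>_def cong: conj_cong)

lemma M_map_eq: "E.M_map d E Es q a = pair.M"
  by (rule ext) (simp add: E.M_map_def pair.M_def K_map_eq B_map_eq)

text \<open>Exchanging \<open>K\<close> with B and \<open>a\<close> with its inverse changes the
  sign of both numerator and denominator of \<open>M\<close>.\<close>

lemma rev_M_eq: "rev_pair.M = pair.M"
proof
  fix v
  have "inverse (inverse a - a) = - inverse (a - inverse a)"
    by (metis inverse_minus_eq minus_diff_eq)
  then show "rev_pair.M v = pair.M v"
    by (simp add: rev_pair.M_def pair.M_def algebra_simps)
qed

text \<open>A vector of the i-th eigenspace lies in \<open>G i\<close> and in the reversed
  \<open>G (d - i)\<close>. Applying \<open>M_inverse_G\<close> in both orders bounds the components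
  of its preimage from below and above.\<close>

theorem M_map_inverse_tridiagonal:
  assumes i: "i \<le> d"
  shows "inv (E.M_map d E Es q a) ` range (E i) \<subseteq> neighbour_sum d (\<lambda>j. range (E j)) i"
proof -
  have "inv pair.M w \<in> neighbour_sum d (\<lambda>j. range (E j)) i" if "w \<in> range (E i)" for w
  proof -
    define y where "y = inv pair.M w"
    have My: "pair.M y = w" unfolding y_def by (simp add: pair.bij_M bij_is_surj surj_f_inv_f)
    have zero: "E j w = 0" if "j \<le> d" "j \<noteq> i" for j
      using \<open>w \<in> range (E i)\<close> E.orth[of j i] that i by auto
    have "pair.M y \<in> G i" unfolding My E.above_def using zero by auto
    then have lo: "y \<in> G (i - 1)" by (rule pair.M_inverse_G)
    have "rev_pair.M y \<in> rev.G (d - i)" unfolding rev_M_eq My rev.E.above_def using zero i by auto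
    \<comment> \<open>In the original order this kills the components with index above
      \<open>i + 1\<close>; for \<open>i = d\<close> the truncated index is 0 and imposes no
      condition.\<close>
    then have hi: "y \<in> rev.G (d - i - 1)" by (rule rev_pair.M_inverse_G)
    have y0: "E j y = 0" if "j \<le> d" "j + 1 < i \<or> i + 1 < j" for j
      using that(2)
    proof
      assume "j + 1 < i"
      then show ?thesis using lo that(1) by (auto simp: E.above_def)
    next
      assume "i + 1 < j"
      then have "d - j < d - i - 1" using that(1) by simp
      then have "E (d - (d - j)) y = 0" using hi by (simp add: rev.E.above_def)
      then show ?thesis using that(1) by simp
    qed
    define x where "x m = (if 0 \<le> m \<and> m \<le> int d then E (nat m) y else 0)" for m
    have xm: "x m \<in> padded d (\<lambda>j. range (E j)) m" for m
      by (auto simp: x_def padded_def)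
    have "y = (\<Sum>j\<le>d. E j y)" by (simp add: E.complete)
    also have "\<dots> = (\<Sum>m\<in>int ` {..d}. x m)"
      by (subst sum.reindex) (auto simp: x_def)
    \<comment> \<open>The two index sets differ only where \<open>x\<close> vanishes: at neighbours
      outside the range from 0 to \<open>d\<close>, or at indices not adjacent to
      \<open>i\<close>.\<close>
    also have "\<dots> = (\<Sum>m\<in>{int i - 1, int i, int i + 1}. x m)"
    proof (rule sum.mono_neutral_cong)
      show "x m = 0" if "m \<in> {int i - 1, int i, int i + 1} - int ` {..d}" for m
      proof -
        have "m \<in> int ` {..d}" if "0 \<le> m \<and> m \<le> int d"
          using that by (intro image_eqI[of _ _ "nat m"]) auto
        then show ?thesis using that by (auto simp: x_def)
      qed
      show "x m = 0" if "m \<in> int ` {..d} - {int i - 1, int i, int i + 1}" for m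
        using that by (auto simp: x_def intro!: y0)
    qed auto
    also have "\<dots> = x (int i - 1) + x (int i) + x (int i + 1)" by simp
    finally show ?thesis
      unfolding y_def[symmetric] neighbour_sum_def using xm by (auto intro: set_plus_intro)
  qed
  then show ?thesis by (auto simp: M_map_eq)
qed

end

theorem lemma10p3:
  fixes scale :: "'k::alg_closed_field \<Rightarrow> 'v::ab_group_add \<Rightarrow> 'v"
    and Basis :: "'v set"
    and A As :: "'v \<Rightarrow> 'v"
    and E Es :: "nat \<Rightarrow> 'v \<Rightarrow> 'v"
    and q a b :: 'k
    and d i :: nat
  assumes "finite_dimensional_vector_space scale Basis"
    and "vector_space.dim scale (UNIV :: 'v set) > 0"
    and "td_space.td_system scale d A E As Es"
    and "d \<ge> 1"
    and "td_space.q_Racah scale d A E As Es q a b"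
    and "i \<le> d"
  shows "inv (td_space.M_map scale d E Es q a) ` range (E i)
           \<subseteq> neighbour_sum d (\<lambda>j. range (E j)) i"
proof -
  interpret td_space scale
    using assms(1) by (simp add: td_space_def finite_dimensional_vector_space_def)
  interpret split_system scale d E Es A As "\<lambda>i. eigenvalue_on A (range (E i))"
    "\<lambda>i. eigenvalue_on As (range (Es i))"
    by (rule td_system_imp_split_system[OF assms(3)])
  define \<kappa> where "\<kappa> i = q powi (int d - 2 * int i)" for i :: nat
  have \<kappa>_inv: "q powi (2 * int i - int d) = inverse (\<kappa> i)" for i
    unfolding \<kappa>_def power_int_minus[symmetric] by simp
  have q: "q \<noteq> 0" "a \<noteq> 0" "b \<noteq> 0"
    and \<theta>: "\<And>i. i \<le> d \<Longrightarrow> eigenvalue_on A (range (E i)) = a * \<kappa> i + inverse a * inverse (\<kappa> i)"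
    and \<theta>s: "\<And>i. i \<le> d \<Longrightarrow> eigenvalue_on As (range (Es i)) = b * \<kappa> i + inverse b * inverse (\<kappa> i)"
    using assms(5) by (auto simp: q_Racah_def \<kappa>_inv) (simp_all add: \<kappa>_def)
  have inj: "eigenvalue_on A (range (E i)) \<noteq> eigenvalue_on A (range (E j))"
    if "i \<le> d" "j \<le> d" "i \<noteq> j" for i j
    using primitive_idempotents(5)[of A d E As i j] assms(3) that
    by (simp add: td_system_def td_pair_def)
  \<comment> \<open>Otherwise \<open>a\<close> is its own inverse, and the eigenvalues of indices 0
    and \<open>d\<close> coincide, although these indices differ.\<close>
  have "a * a \<noteq> 1"
  proof
    assume "a * a = 1"
    then have "inverse a = a" by (rule inverse_unique)
    moreover have "\<kappa> d = inverse (\<kappa> 0)" by (simp add: \<kappa>_def power_int_minus)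
    ultimately show False using inj[of 0 d] assms(4) by (simp add: \<theta>)
  qed
  \<comment> \<open>Each eigenvalue is a function of \<open>\<kappa>\<close>, so equal values of
    \<open>\<kappa>\<close> would give equal eigenvalues.\<close>
  moreover have "\<kappa> i \<noteq> \<kappa> j" if "i \<le> d" "j \<le> d" "i \<noteq> j" for i j
    using inj[OF that] that by (auto simp: \<theta>)
  ultimately interpret q_racah_split scale d E Es A As "\<lambda>i. eigenvalue_on A (range (E i))"
    "\<lambda>i. eigenvalue_on As (range (Es i))" q a b \<kappa>
    by unfold_locales (use q \<theta> \<theta>s \<kappa>_def in auto)
  show ?thesis by (rule M_map_inverse_tridiagonal[OF assms(6)])
qed

end
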